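(* Let $V$ be a set of $n$ nodes, $\mathcal{C}\subseteq 2^V$ a collection of nonempty co-occurrence sets with weights $w_c>0$, and $G=(V,E)$ the corresponding co-occurrence graph. Let $\varepsilon>0$ and $f(\varepsilon)=\varepsilon^{-1/2}\log\log\frac{1}{\varepsilon}$. Then there exists an $\varepsilon$-augmented cut sparsifier for $G$ with $O(n+|\mathcal{C}|\cdot f(\varepsilon))$ nodes and $O(n\cdot d_{\mathit{avg}}\cdot f(\varepsilon))$ edges. In particular, if $d_{\mathit{avg}}$ is constant and for some $\delta>0$ we have $\sum_{c\in\mathcal{C}}|c|^2=\Omega(n^{1+\delta})$, then forming $G$ explicitly (by placing all edges of the cliques induced by the sets $c\in\mathcal{C}$) takes $\Omega(n^{1+\delta})$ time, whereas an $\varepsilon$-augmented cut sparsifier for $G$ with $O(nf(\varepsilon))$ nodes and $O(nf(\varepsilon))$ edges can be constructed in $O(nf(\varepsilon))$ time.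
   Context: The co-occurrence graph $G$ on $\mathcal{C}$ has an undirected edge between nodes $i\neq j$ with weight $w_{ij}=\sum_{c\in\mathcal{C}:\,i,j\in c}w_c$; its cut function is $\mathbf{cut}_G(S)=\sum_{c\in\mathcal{C}}w_c\,|S\cap c|\,|\bar S\cap c|$ with $\bar S=V\setminus S$. The co-occurrence degree $d_v$ of $v\in V$ is the number of sets $c\in\mathcal{C}$ containing $v$, and $d_{\mathit{avg}}=\frac1n\sum_{v\in V}d_v$. For a directed graph $\hat G=(V\cup\mathcal{A},\hat E)$ with nonnegative edge weights and auxiliary node set $\mathcal{A}$ disjoint from $V$, $\mathbf{dircut}_{\hat G}(U)$ is the total weight of edges leaving $U$, and $\mathbf{cut}_{\hat G}(S)=\min_{T\subseteq\mathcal{A}}\mathbf{dircut}_{\hat G}(S\cup T)$ for $S\subseteq V$. $\hat G$ is an $\varepsilon$-augmented cut sparsifier for $G$ if $\mathbf{cut}_G(S)\le\mathbf{cut}_{\hat G}(S)\le(1+\varepsilon)\mathbf{cut}_G(S)$ for all $S\subseteq V$. Asymptotic notation in $\varepsilon$ refers to the regime $\varepsilon\to0$. *)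

theory Defs
  imports
    Complex_Main
    "HOL-Library.Multiset"
    "HOL-Library.Landau_Symbols"
    "HOL-Library.Infinite_Typeclass"
begin

definition cooccurrence_instance :: "'a set \<Rightarrow> 'a set set \<Rightarrow> ('a set \<Rightarrow> real) \<Rightarrow> bool" where
  "cooccurrence_instance V C w \<longleftrightarrow>
     finite V \<and> C \<subseteq> Pow V \<and> {} \<notin> C \<and> (\<forall>c\<in>C. w c > 0)"

definition cooc_weight :: "'a set set \<Rightarrow> ('a set \<Rightarrow> real) \<Rightarrow> 'a \<Rightarrow> 'a \<Rightarrow> real" where
  "cooc_weight C w i j = (if i = j then 0 else (\<Sum>c | c \<in> C \<and> i \<in> c \<and> j \<in> c. w c))"

definition cooc_cut :: "'a set \<Rightarrow> 'a set set \<Rightarrow> ('a set \<Rightarrow> real) \<Rightarrow> 'a set \<Rightarrow> real" where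
  "cooc_cut V C w S = (\<Sum>i\<in>S. \<Sum>j\<in>V - S. cooc_weight C w i j)"

lemma cooc_cut_eq:
  assumes "cooccurrence_instance V C w" and "S \<subseteq> V"
  shows "cooc_cut V C w S = (\<Sum>c\<in>C. w c * real (card (S \<inter> c)) * real (card ((V - S) \<inter> c)))"
proof -
  have fV: "finite V" and fC: "finite C"
    using assms(1) by (auto simp: cooccurrence_instance_def intro: finite_subset)
  have fS: "finite S" and fT: "finite (V - S)"
    using fV assms(2) by (auto intro: finite_subset)
  have ind: "(\<Sum>i\<in>X. of_bool (i \<in> c)) = real (card (X \<inter> c))" if "finite X" for X c :: "'a set"
    using that by (simp add: of_bool_def flip: sum.inter_restrict)
  have "cooc_cut V C w S =
      (\<Sum>i\<in>S. \<Sum>j\<in>V - S. \<Sum>c\<in>C. w c * of_bool (i \<in> c) * of_bool (j \<in> c))"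
    unfolding cooc_cut_def
  proof (intro sum.cong refl)
    fix i j assume ij: "i \<in> S" "j \<in> V - S"
    have "(\<Sum>c | c \<in> C \<and> i \<in> c \<and> j \<in> c. w c)
        = (\<Sum>c\<in>C. if i \<in> c \<and> j \<in> c then w c else 0)"
      using fC by (simp add: sum.inter_filter)
    also have "\<dots> = (\<Sum>c\<in>C. w c * of_bool (i \<in> c) * of_bool (j \<in> c))"
      by (intro sum.cong) auto
    finally show "cooc_weight C w i j = (\<Sum>c\<in>C. w c * of_bool (i \<in> c) * of_bool (j \<in> c))"
      using ij by (auto simp: cooc_weight_def)
  qed
  also have "\<dots> = (\<Sum>i\<in>S. \<Sum>c\<in>C. \<Sum>j\<in>V - S. w c * of_bool (i \<in> c) * of_bool (j \<in> c))"
    by (intro sum.cong refl sum.swap)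
  also have "\<dots> = (\<Sum>c\<in>C. \<Sum>i\<in>S. \<Sum>j\<in>V - S. w c * of_bool (i \<in> c) * of_bool (j \<in> c))"
    by (rule sum.swap)
  also have "\<dots> = (\<Sum>c\<in>C. w c * real (card (S \<inter> c)) * real (card ((V - S) \<inter> c)))"
    using ind[OF fS] ind[OF fT]
    by (simp flip: sum_distrib_left sum_distrib_right)
  finally show ?thesis .
qed

definition cooc_degree :: "'a set set \<Rightarrow> 'a \<Rightarrow> nat" where
  "cooc_degree C v = card {c \<in> C. v \<in> c}"

definition avg_degree :: "'a set \<Rightarrow> 'a set set \<Rightarrow> real" where
  "avg_degree V C = (\<Sum>v\<in>V. real (cooc_degree C v)) / real (card V)"

text \<open>
  The augmented digraph has node set \<open>V \<union> A\<close>, edge set \<open>E\<close> and edge weights \<open>x\<close>.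
\<close>

definition augmented_digraph ::
  "'a set \<Rightarrow> 'a set \<Rightarrow> ('a \<times> 'a) set \<Rightarrow> ('a \<times> 'a \<Rightarrow> real) \<Rightarrow> bool" where
  "augmented_digraph V A E x \<longleftrightarrow>
     finite A \<and> A \<inter> V = {} \<and> E \<subseteq> (V \<union> A) \<times> (V \<union> A) \<and> (\<forall>e\<in>E. x e \<ge> 0)"

definition dircut :: "('a \<times> 'a) set \<Rightarrow> ('a \<times> 'a \<Rightarrow> real) \<Rightarrow> 'a set \<Rightarrow> real" where
  "dircut E x U = (\<Sum>e | e \<in> E \<and> fst e \<in> U \<and> snd e \<notin> U. x e)"

definition augmented_cut ::
  "'a set \<Rightarrow> ('a \<times> 'a) set \<Rightarrow> ('a \<times> 'a \<Rightarrow> real) \<Rightarrow> 'a set \<Rightarrow> real" where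
  "augmented_cut A E x S = Min ((\<lambda>T. dircut E x (S \<union> T)) ` Pow A)"

definition augmented_cut_sparsifier ::
  "real \<Rightarrow> 'a set \<Rightarrow> 'a set set \<Rightarrow> ('a set \<Rightarrow> real) \<Rightarrow>
   'a set \<Rightarrow> ('a \<times> 'a) set \<Rightarrow> ('a \<times> 'a \<Rightarrow> real) \<Rightarrow> bool" where
  "augmented_cut_sparsifier \<epsilon> V C w A E x \<longleftrightarrow>
     augmented_digraph V A E x \<and>
     (\<forall>S\<subseteq>V. cooc_cut V C w S \<le> augmented_cut A E x S \<and>
            augmented_cut A E x S \<le> (1 + \<epsilon>) * cooc_cut V C w S)"

text \<open>
  Meaningful only for small \<open>\<epsilon>\<close>: for \<open>\<epsilon> \<ge> exp (-1)\<close> the iterated logarithm is not positive.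
\<close>

definition sparsity_factor :: "real \<Rightarrow> real" where
  "sparsity_factor \<epsilon> = \<epsilon> powr (-1/2) * ln (ln (1 / \<epsilon>))"

text \<open>
  Running times refer to a real RAM in structured form: separate unbounded stores for natural
  numbers (used for nodes, counters and addresses) and for real numbers, each with named variables
  and an indirectly addressed memory.  Reals support field operations and comparison, but there is
  no conversion from reals to naturals, so rounding is not available as a primitive.
  \<open>Emit u v r\<close> places one edge from \<open>u\<close> to \<open>v\<close> of weight \<open>r\<close> on a write-only output list.
  Each command, each guard evaluation and each node of an evaluated expression costs one step.
\<close>

datatype nexp =
    NConst nat
  | NVar nat
  | NMem nexp
  | NAdd nexp nexp
  | NSub nexp nexp

datatype rexp =
    RConst int
  | RVar nat
  | RMem nexp
  | ROfNat nexp
  | RAdd rexp rexp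
  | RSub rexp rexp
  | RMul rexp rexp
  | RDiv rexp rexp

datatype bexp =
    NLess nexp nexp
  | RLess rexp rexp
  | BNot bexp

datatype com =
    Skip
  | NAssign nat nexp
  | NStore nexp nexp
  | RAssign nat rexp
  | RStore nexp rexp
  | Emit nexp nexp rexp
  | Seq com com
  | Cond bexp com com
  | Loop bexp com

record state =
  nvar :: "nat \<Rightarrow> nat"
  nmem :: "nat \<Rightarrow> nat"
  rvar :: "nat \<Rightarrow> real"
  rmem :: "nat \<Rightarrow> real"
  emitted :: "(nat \<times> nat \<times> real) list"

primrec nval :: "nexp \<Rightarrow> state \<Rightarrow> nat" where
  "nval (NConst k) s = k"
| "nval (NVar i) s = nvar s i"
| "nval (NMem a) s = nmem s (nval a s)"
| "nval (NAdd a b) s = nval a s + nval b s"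
| "nval (NSub a b) s = nval a s - nval b s"

primrec ncost :: "nexp \<Rightarrow> nat" where
  "ncost (NConst k) = 1"
| "ncost (NVar i) = 1"
| "ncost (NMem a) = 1 + ncost a"
| "ncost (NAdd a b) = 1 + ncost a + ncost b"
| "ncost (NSub a b) = 1 + ncost a + ncost b"

primrec rval :: "rexp \<Rightarrow> state \<Rightarrow> real" where
  "rval (RConst k) s = of_int k"
| "rval (RVar i) s = rvar s i"
| "rval (RMem a) s = rmem s (nval a s)"
| "rval (ROfNat a) s = real (nval a s)"
| "rval (RAdd a b) s = rval a s + rval b s"
| "rval (RSub a b) s = rval a s - rval b s"
| "rval (RMul a b) s = rval a s * rval b s"
| "rval (RDiv a b) s = rval a s / rval b s"

primrec rcost :: "rexp \<Rightarrow> nat" where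
  "rcost (RConst k) = 1"
| "rcost (RVar i) = 1"
| "rcost (RMem a) = 1 + ncost a"
| "rcost (ROfNat a) = 1 + ncost a"
| "rcost (RAdd a b) = 1 + rcost a + rcost b"
| "rcost (RSub a b) = 1 + rcost a + rcost b"
| "rcost (RMul a b) = 1 + rcost a + rcost b"
| "rcost (RDiv a b) = 1 + rcost a + rcost b"

primrec bval :: "bexp \<Rightarrow> state \<Rightarrow> bool" where
  "bval (NLess a b) s \<longleftrightarrow> nval a s < nval b s"
| "bval (RLess a b) s \<longleftrightarrow> rval a s < rval b s"
| "bval (BNot b) s \<longleftrightarrow> \<not> bval b s"

primrec bcost :: "bexp \<Rightarrow> nat" where
  "bcost (NLess a b) = 1 + ncost a + ncost b"
| "bcost (RLess a b) = 1 + rcost a + rcost b"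
| "bcost (BNot b) = 1 + bcost b"

text \<open>\<open>exec p s t s'\<close>: program \<open>p\<close> started in \<open>s\<close> halts in \<open>s'\<close> after exactly \<open>t\<close> steps.\<close>

inductive exec :: "com \<Rightarrow> state \<Rightarrow> nat \<Rightarrow> state \<Rightarrow> bool" where
  exec_Skip: "exec Skip s 1 s"
| exec_NAssign: "exec (NAssign i a) s (1 + ncost a) (s\<lparr>nvar := (nvar s)(i := nval a s)\<rparr>)"
| exec_NStore: "exec (NStore a b) s (1 + ncost a + ncost b)
    (s\<lparr>nmem := (nmem s)(nval a s := nval b s)\<rparr>)"
| exec_RAssign: "exec (RAssign i r) s (1 + rcost r) (s\<lparr>rvar := (rvar s)(i := rval r s)\<rparr>)"
| exec_RStore: "exec (RStore a r) s (1 + ncost a + rcost r)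
    (s\<lparr>rmem := (rmem s)(nval a s := rval r s)\<rparr>)"
| exec_Emit: "exec (Emit a b r) s (1 + ncost a + ncost b + rcost r)
    (s\<lparr>emitted := emitted s @ [(nval a s, nval b s, rval r s)]\<rparr>)"
| exec_Seq: "exec p s t s' \<Longrightarrow> exec q s' t' s'' \<Longrightarrow> exec (Seq p q) s (t + t') s''"
| exec_CondT: "bval b s \<Longrightarrow> exec p s t s' \<Longrightarrow> exec (Cond b p q) s (1 + bcost b + t) s'"
| exec_CondF: "\<not> bval b s \<Longrightarrow> exec q s t s' \<Longrightarrow> exec (Cond b p q) s (1 + bcost b + t) s'"
| exec_LoopF: "\<not> bval b s \<Longrightarrow> exec (Loop b p) s (1 + bcost b) s"
| exec_LoopT: "bval b s \<Longrightarrow> exec p s t s' \<Longrightarrow> exec (Loop b p) s' t' s'' \<Longrightarrow>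
    exec (Loop b p) s (1 + bcost b + t + t') s''"

text \<open>
  \<open>enumerates cs C\<close>: the list of lists \<open>cs\<close> presents the collection \<open>C\<close>, in an arbitrary order of
  the sets and of the members of each set.
\<close>

definition enumerates :: "nat list list \<Rightarrow> nat set set \<Rightarrow> bool" where
  "enumerates cs C \<longleftrightarrow>
     distinct (map set cs) \<and> (\<forall>c\<in>set cs. distinct c) \<and> set ` set cs = C"

definition mem_of_list :: "'b::zero list \<Rightarrow> nat \<Rightarrow> 'b" where
  "mem_of_list xs i = (if i < length xs then xs ! i else 0)"

text \<open>
  The node set is \<open>{..<n}\<close>.  Natural number variables 0 and 1 hold \<open>n\<close> and the number of sets, real
  variable 0 holds \<open>\<epsilon>\<close>; the natural number memory holds the sets one after the other, each one
  preceded by its size, and the real memory holds the weights of the sets in the same order.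
\<close>

definition input_state :: "nat \<Rightarrow> nat list list \<Rightarrow> (nat set \<Rightarrow> real) \<Rightarrow> real \<Rightarrow> state" where
  "input_state n cs w \<epsilon> =
     \<lparr>nvar = (\<lambda>_. 0)(0 := n, 1 := length cs),
      nmem = mem_of_list (concat (map (\<lambda>c. length c # c) cs)),
      rvar = (\<lambda>_. 0)(0 := \<epsilon>),
      rmem = mem_of_list (map (\<lambda>c. w (set c)) cs),
      emitted = []\<rparr>"

text \<open>
  A halting state describes the digraph with nodes \<open>{..<N}\<close>, where \<open>N\<close> is the final value of natural
  number variable 0, and the emitted edges; the weights of parallel edges add up.
\<close>

definition output_nodes :: "state \<Rightarrow> nat set" where
  "output_nodes s = {..<nvar s 0}"

definition output_edges :: "state \<Rightarrow> (nat \<times> nat) set" where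
  "output_edges s = (\<lambda>(u, v, r). (u, v)) ` set (emitted s)"

definition output_weight :: "state \<Rightarrow> nat \<times> nat \<Rightarrow> real" where
  "output_weight s e = (\<Sum>(u, v, r) \<leftarrow> emitted s. if (u, v) = e then r else 0)"

text \<open>
  The output places, for every set \<open>c\<close> of the collection, every edge of the clique on \<open>c\<close> with weight
  \<open>w c\<close>.  Edges are undirected here, and a pair contained in several sets is placed once for
  each of them.
\<close>

definition places_cliques :: "nat set set \<Rightarrow> (nat set \<Rightarrow> real) \<Rightarrow> state \<Rightarrow> bool" where
  "places_cliques C w s \<longleftrightarrow>
     image_mset (\<lambda>(u, v, r). ({u, v}, r)) (mset (emitted s)) =
     (\<Sum>c\<in>C. image_mset (\<lambda>e. (e, w c)) (mset_set {e. e \<subseteq> c \<and> card e = 2}))"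

text \<open>
  \<open>forms_explicitly p n C w t\<close>: on some presentation of the instance, program \<open>p\<close> forms the
  co-occurrence graph by placing all clique edges, in \<open>t\<close> steps.  The accuracy parameter plays no
  role for this task, and its input cell is 0.
\<close>

definition forms_explicitly ::
  "com \<Rightarrow> nat \<Rightarrow> nat set set \<Rightarrow> (nat set \<Rightarrow> real) \<Rightarrow> nat \<Rightarrow> bool" where
  "forms_explicitly p n C w t \<longleftrightarrow>
     (\<exists>cs s. enumerates cs C \<and> exec p (input_state n cs w 0) t s \<and> places_cliques C w s)"

end

theory Submission
  imports Defs
begin

text \<open>
  A set of size \<open>k\<close> contributes \<open>k\<^sup>2 x (1 - x)\<close> to the cut, where \<open>x\<close> is the fraction of its members
  in \<open>S\<close>.  The parabola \<open>x (1 - x)\<close> is replaced by the lower envelope of its tangents at knots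
  \<open>0 = t\<^sub>0 < \<dots> < t\<^sub>J = 1\<close>.  This envelope is a sum of \<open>J\<close> tents \<open>min (a x) (b (1 - x))\<close>, one for each
  kink, and a tent is the cut function of a star around one auxiliary node with weight \<open>a\<close> on its
  incoming and \<open>b\<close> on its outgoing edges.

  Near \<open>x\<close> the error is quadratic in the spacing of the knots while \<open>\<epsilon> x (1 - x)\<close> is allowed, so the
  spacing may grow like \<open>sqrt (\<epsilon> x (1 - x))\<close>.  Knots that cluster quadratically at both ends
  need only \<open>J = O(\<epsilon>\<^sup>-\<^sup>1\<^sup>/\<^sup>2)\<close> pieces, and rational ones can be computed by the program,
  which has neither roots nor rounding.
\<close>

subsection \<open>Tangent approximation of the parabola\<close>

lemma ex_knot_interval:
  fixes t :: "nat \<Rightarrow> real"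
  assumes "t 0 \<le> x" "x \<le> t J" "J > 0"
  shows "\<exists>i<J. t i \<le> x \<and> x \<le> t (Suc i)"
  using assms
proof (induction J)
  case (Suc J)
  show ?case
  proof (cases "x \<le> t J \<and> J > 0")
    case True
    then show ?thesis using Suc less_Suc_eq by blast
  next
    case False
    then have "t J \<le> x" using Suc.prems by (cases J) auto
    then show ?thesis using Suc.prems by blast
  qed
qed simp

text \<open>
  The contribution of the kink between the tangents at \<open>p\<close> and \<open>q\<close>; the kink lies at \<open>(p + q) / 2\<close>.
\<close>

definition tent :: "real \<Rightarrow> real \<Rightarrow> real \<Rightarrow> real" where
  "tent p q x = min (x * ((1 - p)\<^sup>2 - (1 - q)\<^sup>2)) ((1 - x) * (q\<^sup>2 - p\<^sup>2))"

text \<open>For \<open>p \<le> q\<close> the two branches of \<open>tent\<close> meet at the kink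
  \<open>(p + q) / 2\<close>: the first is the smaller one to its left, the second to its
  right.\<close>

lemma tent_compare:
  fixes p q x :: real
  shows
  "x * ((1 - p)\<^sup>2 - (1 - q)\<^sup>2) - (1 - x) * (q\<^sup>2 - p\<^sup>2) = (q - p) * (2 * x - (p + q))"
  by (simp add: power2_eq_square algebra_simps)

lemma tent_right:
  assumes "p \<le> q" "q \<le> x"
  shows "tent p q x = (1 - x) * (q\<^sup>2 - p\<^sup>2)"
proof -
  have "0 \<le> (q - p) * (2 * x - (p + q))" using assms by (intro mult_nonneg_nonneg) auto
  then show ?thesis unfolding tent_def using tent_compare[of x p q] by linarith
qed

lemma tent_left:
  assumes "p \<le> q" "x \<le> p"
  shows "tent p q x = x * ((1 - p)\<^sup>2 - (1 - q)\<^sup>2)"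
proof -
  have "(q - p) * (2 * x - (p + q)) \<le> 0" using assms by (intro mult_nonneg_nonpos) auto
  then show ?thesis unfolding tent_def using tent_compare[of x p q] by linarith
qed

text \<open>Tents left of the interval telescope to \<open>(1 - x) * (t i)^2\<close>, tents right of
  it to \<open>x * (1 - t (Suc i))^2\<close>. With the middle tent they add up to the smaller of the
  tangents at \<open>t i\<close> and \<open>t (Suc i)\<close>, and the tangent at \<open>p\<close>
  exceeds the parabola by exactly \<open>(x - p)^2\<close>.\<close>

lemma sum_tent:
  fixes t :: "nat \<Rightarrow> real"
  assumes mono: "\<And>i j. i \<le> j \<Longrightarrow> j \<le> J \<Longrightarrow> t i \<le> t j"
    and ends: "t 0 = 0" "t J = 1"
    and i: "i < J" "t i \<le> x" "x \<le> t (Suc i)"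
  shows "(\<Sum>j<J. tent (t j) (t (Suc j)) x) = x * (1 - x) + min ((x - t i)\<^sup>2) ((t (Suc i) - x)\<^sup>2)"
proof -
  have "{..<J} = {..<i} \<union> {i} \<union> {Suc i..<J}" using i by auto
  then have "(\<Sum>j<J. tent (t j) (t (Suc j)) x)
      = (\<Sum>j\<in>{..<i} \<union> {i} \<union> {Suc i..<J}. tent (t j) (t (Suc j)) x)" by simp
  also have "\<dots> = (\<Sum>j<i. tent (t j) (t (Suc j)) x) + tent (t i) (t (Suc i)) x
      + (\<Sum>j\<in>{Suc i..<J}. tent (t j) (t (Suc j)) x)"
    by (subst sum.union_disjoint; auto)+
  also have "(\<Sum>j<i. tent (t j) (t (Suc j)) x) = (\<Sum>j<i. (1 - x) * ((t (Suc j))\<^sup>2 - (t j)\<^sup>2))"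
  proof (intro sum.cong refl tent_right)
    fix j assume "j \<in> {..<i}"
    then show "t j \<le> t (Suc j)" "t (Suc j) \<le> x"
      using i mono[of "Suc j" i] by (auto intro!: mono)
  qed
  also have "\<dots> = (1 - x) * (t i)\<^sup>2"
    using sum_lessThan_telescope[of "\<lambda>j. (t j)\<^sup>2" i] by (simp add: ends flip: sum_distrib_left)
  also have "(\<Sum>j\<in>{Suc i..<J}. tent (t j) (t (Suc j)) x)
      = (\<Sum>j\<in>{Suc i..<J}. x * ((1 - t j)\<^sup>2 - (1 - t (Suc j))\<^sup>2))"
  proof (intro sum.cong refl tent_left)
    fix j assume "j \<in> {Suc i..<J}"
    then show "t j \<le> t (Suc j)" "x \<le> t j"
      using i mono[of "Suc i" j] by (auto intro!: mono)
  qed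
  also have "\<dots> = x * (1 - t (Suc i))\<^sup>2"
    using sum_Suc_diff'[of "Suc i" J "\<lambda>j. - (1 - t j)\<^sup>2"] i(1)
    by (simp add: ends flip: sum_distrib_left)
  finally have "(\<Sum>j<J. tent (t j) (t (Suc j)) x)
      = (1 - x) * (t i)\<^sup>2 + tent (t i) (t (Suc i)) x + x * (1 - t (Suc i))\<^sup>2" .
  \<comment> \<open>The first branch of the tent leaves
    \<open>(1 - x) * p^2 + x * (1 - p)^2\<close>, the value at \<open>x\<close> of the tangent at
    \<open>p\<close>; the second branch leaves that of the tangent at \<open>q\<close>.\<close>
  moreover have "(1 - x) * p\<^sup>2 + tent p q x + x * (1 - q)\<^sup>2
      = x * (1 - x) + min ((x - p)\<^sup>2) ((q - x)\<^sup>2)" for p q :: real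
    unfolding tent_def min_def
    by (auto simp: power2_eq_square algebra_simps)
  ultimately show ?thesis by simp
qed

lemma min_power2_le_mult:
  fixes a b :: real
  assumes "0 \<le> a" "0 \<le> b"
  shows "min (a\<^sup>2) (b\<^sup>2) \<le> a * b"
  using assms mult_left_mono[of a b a] mult_left_mono[of b a b]
  by (cases "a \<le> b") (auto simp: power2_eq_square min_le_iff_disj mult.commute)

text \<open>The smaller square is at most \<open>(x - p) * (q - x)\<close>, and a concavity-type
  estimate bounds this product times \<open>q * (1 - p)\<close> by
  \<open>x * (1 - x) * (q - p)^2\<close>. The gap is measured against \<open>q * (1 - p)\<close>
  because \<open>p * (1 - q)\<close> vanishes on the first and the last interval.\<close>

lemma interval_error:
  fixes p q x :: real
  assumes "0 \<le> p" "p \<le> x" "x \<le> q" "q \<le> 1" and eps: "(q - p)\<^sup>2 \<le> \<epsilon> * (q * (1 - p))"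
    and pos: "0 < q" "p < 1" 
  shows "min ((x - p)\<^sup>2) ((q - x)\<^sup>2) \<le> \<epsilon> * (x * (1 - x))"
proof -
  have "(x - p) * q \<le> x * (q - p)" using assms(1-3) mult_left_mono[of x q p] by (simp add: algebra_simps)
  moreover have "(q - x) * (1 - p) \<le> (1 - x) * (q - p)" 
    using mult_nonneg_nonneg[of "x-p" "1-q"] assms by (simp add: algebra_simps)
  ultimately have "((x - p) * q) * ((q - x) * (1 - p)) \<le> (x * (q - p)) * ((1 - x) * (q - p))"
    by (rule mult_mono) (use assms in \<open>auto intro: mult_nonneg_nonneg\<close>)
  also have "\<dots> = (x * (1 - x)) * (q - p)\<^sup>2" by (simp add: power2_eq_square)
  also have "\<dots> \<le> (x * (1 - x)) * (\<epsilon> * (q * (1 - p)))"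
    using eps assms by (intro mult_left_mono) auto
  finally have "(x - p) * (q - x) * (q * (1 - p)) \<le> \<epsilon> * (x * (1 - x)) * (q * (1 - p))"
    by (simp add: algebra_simps)
  moreover have "0 < q * (1 - p)" using pos by simp
  ultimately have "(x - p) * (q - x) \<le> \<epsilon> * (x * (1 - x))" by (simp add: mult_le_cancel_right_pos)
  with min_power2_le_mult[of "x - p" "q - x"] assms show ?thesis by simp
qed

section \<open>Rational knots\<close>

text \<open>If tan \<theta> = i / (J - i), this is the square of sin \<theta>: a stand-in for
  equally spaced angles that uses field operations only. Exchanging \<open>i\<close> with
  \<open>J - i\<close> exchanges the knot with its distance from 1.\<close>

definition knot :: "nat \<Rightarrow> nat \<Rightarrow> real" where
  "knot J i = real i * real i / (real i * real i + real (J - i) * real (J - i))"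

text \<open>The two sides differ by the square of \<open>i - (J - i)\<close>. Hence no denominator
  falls below half of \<open>J^2\<close>.\<close>

lemma knot_denominator:
  assumes "i \<le> J"
  shows "(real J)\<^sup>2 \<le> 2 * (real i * real i + real (J - i) * real (J - i))"
proof -
  have "0 \<le> (real i - (real J - real i))\<^sup>2" by simp
  then show ?thesis using assms by (simp add: power2_eq_square algebra_simps of_nat_diff)
qed

lemma knot_ends [simp]:
  shows "knot J 0 = 0" and "J > 0 \<Longrightarrow> knot J J = 1"
  by (auto simp: knot_def)

text \<open>A knot increases with the ratio of \<open>i\<close> to \<open>J - i\<close>. After
  clearing denominators the claim is the inequality \<open>a * d \<le> c * b\<close> multiplied by
  itself.\<close>

lemma knot_mono:
  assumes "i \<le> j" "j \<le> J"
  shows "knot J i \<le> knot J j"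
proof (cases "J = 0")
  case False
  define a b c d where "a = real i" and "b = real (J - i)" and "c = real j" and "d = real (J - j)"
  have D: "0 < a * a + b * b" "0 < c * c + d * d"
    using knot_denominator[of i J] knot_denominator[of j J] assms False
    by (auto simp: a_def b_def c_def d_def) (smt (verit) of_nat_0_less_iff zero_less_power)+
  have "a * d \<le> c * b" unfolding a_def b_def c_def d_def using assms by (intro mult_mono) auto
  from this this have "(a * d) * (a * d) \<le> (c * b) * (c * b)"
    by (rule mult_mono) (simp_all add: a_def b_def c_def d_def)
  then have "a * a / (a * a + b * b) \<le> c * c / (c * c + d * d)"
    using D by (simp add: divide_simps algebra_simps)
  then show ?thesis by (simp add: knot_def a_def b_def c_def d_def)
qed (use assms in simp)

text \<open>Over the common denominator \<open>D * D'\<close> the gap has numerator at most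
  \<open>2 * J * (a * b)\<close> and the right-hand product has numerator \<open>(a * b)^2\<close>.
  What remains is \<open>4 * J^2 \<le> \<epsilon> * (D * D')\<close>; since \<open>D\<close> and
  \<open>D'\<close> are at least \<open>J^2 / 2\<close>, this is where the constant 16 comes
  from.\<close>

lemma knot_gap:
  assumes i: "i < J" and J: "16 \<le> \<epsilon> * (real J)\<^sup>2"
  shows "(knot J (Suc i) - knot J i)\<^sup>2 \<le> \<epsilon> * (knot J (Suc i) * (1 - knot J i))"
proof -
  define a b where "a = real (Suc i)" and "b = real (J - i)"
  have ab: "1 \<le> a" "1 \<le> b" and Jab: "real J = a + b - 1" using i by (auto simp: a_def b_def of_nat_diff)
  define D D' where "D = (a - 1) * (a - 1) + b * b" and "D' = a * a + (b - 1) * (b - 1)"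
  have D: "(real J)\<^sup>2 \<le> 2 * D" "(real J)\<^sup>2 \<le> 2 * D'"
    using knot_denominator[of i J] knot_denominator[of "Suc i" J] i
    by (auto simp: D_def D'_def a_def b_def of_nat_diff algebra_simps)
  have Jpos: "0 < (real J)\<^sup>2" using i by simp
  then have Dpos: "0 < D" "0 < D'" using D by linarith+
  have k: "knot J i = (a - 1) * (a - 1) / D" "knot J (Suc i) = a * a / D'"
    using i by (auto simp: knot_def D_def D'_def a_def b_def of_nat_diff algebra_simps)
  \<comment> \<open>The numerator is \<open>(a * b)^2 - ((a - 1) * (b - 1))^2\<close>, a difference
    of squares whose smaller factor is \<open>a + b - 1 = J\<close>.\<close>
  have gap: "knot J (Suc i) - knot J i = real J * (a * b + (a - 1) * (b - 1)) / (D * D')"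
    using Dpos unfolding k Jab by (simp add: divide_simps) (simp add: D_def D'_def algebra_simps)
  have prod: "knot J (Suc i) * (1 - knot J i) = (a * b)\<^sup>2 / (D * D')"
    using Dpos unfolding k by (simp add: divide_simps power2_eq_square) (simp add: D_def algebra_simps)
  have "(real J * (a * b + (a - 1) * (b - 1)))\<^sup>2 \<le> (real J * (2 * (a * b)))\<^sup>2"
  proof (intro power_mono mult_left_mono)
    show "a * b + (a - 1) * (b - 1) \<le> 2 * (a * b)" using ab by (simp add: algebra_simps)
  qed (use ab in auto)
  also have "\<dots> = (real J)\<^sup>2 * 4 * (a * b)\<^sup>2" by (simp add: power_mult_distrib)
  also have "\<dots> \<le> \<epsilon> * (D * D') * (a * b)\<^sup>2"
  proof (intro mult_right_mono)
    have eps: "0 \<le> \<epsilon>" using J Jpos by (smt (verit) mult_nonpos_nonneg)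
    have "(real J)\<^sup>2 * 16 \<le> (real J)\<^sup>2 * (\<epsilon> * (real J)\<^sup>2)" using J by (intro mult_left_mono) auto
    also have "\<dots> = \<epsilon> * ((real J)\<^sup>2 * (real J)\<^sup>2)" by simp
    also have "\<dots> \<le> \<epsilon> * ((2 * D) * (2 * D'))"
      using D Dpos eps by (intro mult_left_mono mult_mono) auto
    finally show "(real J)\<^sup>2 * 4 \<le> \<epsilon> * (D * D')" by (simp add: mult_ac)
  qed simp
  finally have *: "(real J * (a * b + (a - 1) * (b - 1)))\<^sup>2 \<le> \<epsilon> * (D * D') * (a * b)\<^sup>2" .
  have "(knot J (Suc i) - knot J i)\<^sup>2 = (real J * (a * b + (a - 1) * (b - 1)))\<^sup>2 / (D * D')\<^sup>2"
    by (simp add: gap power_divide)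
  also have "\<dots> \<le> \<epsilon> * (D * D') * (a * b)\<^sup>2 / (D * D')\<^sup>2"
    using * by (intro divide_right_mono) auto
  also have "\<dots> = \<epsilon> * (knot J (Suc i) * (1 - knot J i))"
    using Dpos by (simp add: prod power2_eq_square)
  finally show ?thesis .
qed

lemma sum_tent_knot_bounds:
  assumes J: "J > 0" "16 \<le> \<epsilon> * (real J)\<^sup>2" and x: "0 \<le> x" "x \<le> 1"
  shows "x * (1 - x) \<le> (\<Sum>i<J. tent (knot J i) (knot J (Suc i)) x)"
    and "(\<Sum>i<J. tent (knot J i) (knot J (Suc i)) x) \<le> (1 + \<epsilon>) * (x * (1 - x))"
proof -
  obtain i where i: "i < J" "knot J i \<le> x" "x \<le> knot J (Suc i)"
    using ex_knot_interval[of "knot J" x J] J x by auto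
  note s = sum_tent[OF knot_mono knot_ends(1) knot_ends(2)[OF J(1)] i]
  show "x * (1 - x) \<le> (\<Sum>i<J. tent (knot J i) (knot J (Suc i)) x)"
    by (simp add: s)
  have gap: "(knot J (Suc i) - knot J i)\<^sup>2 \<le> \<epsilon> * (knot J (Suc i) * (1 - knot J i))"
    using knot_gap i(1) J(2) by blast
  have p: "0 < knot J (Suc i)" unfolding knot_def
    by (intro divide_pos_pos add_pos_nonneg mult_pos_pos) auto
  have q: "knot J i < 1" using i(1) unfolding knot_def
    by (subst divide_less_eq_1_pos) (auto intro!: add_nonneg_pos)
  have "0 \<le> knot J i" "knot J (Suc i) \<le> 1"
    using knot_mono[of 0 i J] knot_mono[of "Suc i" J J] i(1) J by auto
  then have "min ((x - knot J i)\<^sup>2) ((knot J (Suc i) - x)\<^sup>2) \<le> \<epsilon> * (x * (1 - x))"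
    using interval_error i gap p q by blast
  then show "(\<Sum>i<J. tent (knot J i) (knot J (Suc i)) x) \<le> (1 + \<epsilon>) * (x * (1 - x))"
    by (simp add: s algebra_simps)
qed

subsection \<open>Stars and their cuts\<close>

text \<open>
  A digraph as the list of its edges with weights; parallel edges are allowed, as in the output of a program.
\<close>

definition list_edges :: "('a \<times> 'a \<times> real) list \<Rightarrow> ('a \<times> 'a) set" where
  "list_edges L = (\<lambda>(u, v, r). (u, v)) ` set L"

definition list_weight :: "('a \<times> 'a \<times> real) list \<Rightarrow> 'a \<times> 'a \<Rightarrow> real" where
  "list_weight L e = (\<Sum>(u, v, r) \<leftarrow> L. if (u, v) = e then r else 0)"

definition list_dircut :: "('a \<times> 'a \<times> real) list \<Rightarrow> 'a set \<Rightarrow> real" where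
  "list_dircut L U = (\<Sum>(u, v, r) \<leftarrow> L. if u \<in> U \<and> v \<notin> U then r else 0)"

lemma list_dircut_concat: "list_dircut (concat Ls) U = (\<Sum>L\<leftarrow>Ls. list_dircut L U)"
  by (induction Ls) (simp_all add: list_dircut_def)

lemma card_list_edges_le: "card (list_edges L) \<le> length L"
  unfolding list_edges_def using card_image_le[of "set L"] card_length[of L] by (meson List.finite_set le_trans)

lemma dircut_list: "dircut (list_edges L) (list_weight L) U = list_dircut L U"
proof -
  \<comment> \<open>The sum runs over a fixed finite superset \<open>F\<close>, since the edge set
    of the list changes along the induction; pairs outside the list have weight 0.\<close>
  have "(\<Sum>e | e \<in> F \<and> fst e \<in> U \<and> snd e \<notin> U. list_weight L e) = list_dircut L U"
    if "finite F" "list_edges L \<subseteq> F" for F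
    using that(2)
  proof (induction L)
    case (Cons l L)
    obtain u v r where l: "l = (u, v, r)" by (cases l)
    have "(\<Sum>e | e \<in> F \<and> fst e \<in> U \<and> snd e \<notin> U. if (u, v) = e then r else 0)
        = (if u \<in> U \<and> v \<notin> U then r else 0)"
      using that(1) Cons.prems by (subst sum.delta') (auto simp: l list_edges_def)
    then show ?case using Cons
      by (simp add: l list_edges_def list_weight_def list_dircut_def sum.distrib)
  qed (simp add: list_weight_def list_dircut_def)
  then show ?thesis unfolding dircut_def by (simp add: list_edges_def)
qed

definition star_edges :: "'a list \<Rightarrow> 'a \<Rightarrow> real \<Rightarrow> real \<Rightarrow> ('a \<times> 'a \<times> real) list" where
  "star_edges c z \<alpha> \<beta> = concat (map (\<lambda>v. [(v, z, \<alpha>), (z, v, \<beta>)]) c)"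

lemma length_star_edges [simp]: "length (star_edges c z \<alpha> \<beta>) = 2 * length c"
  by (induction c) (simp_all add: star_edges_def)

lemma list_dircut_star:
  "list_dircut (star_edges c z \<alpha> \<beta>) U =
     (if z \<in> U then \<beta> * length (filter (\<lambda>v. v \<notin> U) c) else \<alpha> * length (filter (\<lambda>v. v \<in> U) c))"
  by (induction c) (auto simp: star_edges_def list_dircut_def algebra_simps)

text \<open>The minimum is taken separately at each star since no two of them share a center.\<close>

lemma augmented_cut_stars:
  fixes c :: "'i \<Rightarrow> 'a list" and z :: "'i \<Rightarrow> 'a"
  defines "L \<equiv> \<lambda>I \<alpha> \<beta>. concat (map (\<lambda>i. star_edges (c i) (z i) (\<alpha> i) (\<beta> i)) I)"
  assumes inj: "inj_on z (set I)" and A: "A = z ` set I" "A \<inter> V = {}"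
    and c: "\<And>i. i \<in> set I \<Longrightarrow> set (c i) \<subseteq> V" and S: "S \<subseteq> V"
  shows "augmented_cut A (list_edges (L I \<alpha> \<beta>)) (list_weight (L I \<alpha> \<beta>)) S =
    (\<Sum>i\<leftarrow>I. min (\<alpha> i * length (filter (\<lambda>v. v \<in> S) (c i))) (\<beta> i * length (filter (\<lambda>v. v \<notin> S) (c i))))"
    (is "_ = (\<Sum>i\<leftarrow>I. min (?a i) (?b i))")
proof -
  have cut: "list_dircut (L I \<alpha> \<beta>) (S \<union> T) = (\<Sum>i\<leftarrow>I. if z i \<in> T then ?b i else ?a i)"
    if T: "T \<subseteq> A" for T
  proof -
    have "filter (\<lambda>v. v \<notin> S \<union> T) (c i) = filter (\<lambda>v. v \<notin> S) (c i)"
      "filter (\<lambda>v. v \<in> S \<union> T) (c i) = filter (\<lambda>v. v \<in> S) (c i)"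
      "z i \<in> S \<union> T \<longleftrightarrow> z i \<in> T" if "i \<in> set I" for i
    proof -
      have ci: "set (c i) \<subseteq> V" and zi: "z i \<in> A" using c A that by auto
      have "v \<notin> T" if "v \<in> set (c i)" for v using that ci T A by auto
      then show "filter (\<lambda>v. v \<notin> S \<union> T) (c i) = filter (\<lambda>v. v \<notin> S) (c i)"
        "filter (\<lambda>v. v \<in> S \<union> T) (c i) = filter (\<lambda>v. v \<in> S) (c i)"
        by (simp_all cong: filter_cong)
      show "z i \<in> S \<union> T \<longleftrightarrow> z i \<in> T" using zi A S by auto
    qed
    note same = this
    show ?thesis
      unfolding L_def list_dircut_concat map_map comp_def list_dircut_star
      by (rule arg_cong[where f = sum_list], rule map_cong[OF refl]) (simp only: same)
  qed
  \<comment> \<open>The optimal auxiliary set: a center joins the source side exactly when cutting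
    its outgoing edges costs no more than cutting its incoming ones.\<close>
  let ?T = "z ` {i \<in> set I. ?b i \<le> ?a i}"
  have T: "?T \<subseteq> A" using A by auto
  have if_min: "(if b \<le> a then b else a) = min a b" for a b :: real by auto
  have zT: "z i \<in> ?T \<longleftrightarrow> ?b i \<le> ?a i" if "i \<in> set I" for i
    using inj_on_image_mem_iff[OF inj that] that by simp
  have "list_dircut (L I \<alpha> \<beta>) (S \<union> ?T) = (\<Sum>i\<leftarrow>I. min (?a i) (?b i))"
    unfolding cut[OF T]
    by (rule arg_cong[where f = sum_list], rule map_cong[OF refl])
      (simp only: zT if_min)
  moreover have "(\<Sum>i\<leftarrow>I. min (?a i) (?b i)) \<le> list_dircut (L I \<alpha> \<beta>) (S \<union> T)" if "T \<subseteq> A" for T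
    unfolding cut[OF that] by (intro sum_list_mono) auto
  ultimately show ?thesis
    unfolding augmented_cut_def dircut_list
  proof (intro Min_eqI)
    assume "list_dircut (L I \<alpha> \<beta>) (S \<union> ?T) = (\<Sum>i\<leftarrow>I. min (?a i) (?b i))"
    from this[symmetric] show "(\<Sum>i\<leftarrow>I. min (?a i) (?b i)) \<in> (\<lambda>T. list_dircut (L I \<alpha> \<beta>) (S \<union> T)) ` Pow A"
      by (rule image_eqI) (use T in simp)
  qed (use A in auto)
qed

section \<open>Approximating the cut of one clique\<close>

text \<open>The tent has to be scaled by \<open>k^2 * \<omega>\<close>. One factor \<open>k\<close>
  turns the fraction \<open>x\<close> into the number of members in \<open>S\<close>, so a single
  edge carries \<open>k * \<omega>\<close> times the coefficient of the tent.\<close>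

definition in_weight :: "nat \<Rightarrow> nat \<Rightarrow> real \<Rightarrow> nat \<Rightarrow> real" where
  "in_weight J k \<omega> i = real k * \<omega> * ((1 - knot J i)\<^sup>2 - (1 - knot J (Suc i))\<^sup>2)"

definition out_weight :: "nat \<Rightarrow> nat \<Rightarrow> real \<Rightarrow> nat \<Rightarrow> real" where
  "out_weight J k \<omega> i = real k * \<omega> * ((knot J (Suc i))\<^sup>2 - (knot J i)\<^sup>2)"

lemma clique_approximation:
  assumes J: "J > 0" "16 \<le> \<epsilon> * (real J)\<^sup>2" and \<omega>: "0 \<le> \<omega>"
  shows "\<omega> * real s * real s' \<le>
      (\<Sum>i<J. min (in_weight J (s + s') \<omega> i * s) (out_weight J (s + s') \<omega> i * s'))" (is "?g \<le> ?h")
    and "(\<Sum>i<J. min (in_weight J (s + s') \<omega> i * s) (out_weight J (s + s') \<omega> i * s'))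
      \<le> (1 + \<epsilon>) * (\<omega> * real s * real s')"
proof -
  have "?g \<le> ?h \<and> ?h \<le> (1 + \<epsilon>) * ?g"
  proof (cases "s + s' = 0")
    case False
    define k x where "k = real (s + s')" and "x = real s / k"
    have k: "k > 0" using False unfolding k_def by linarith
    have sx: "real s = k * x" "real s' = k * (1 - x)" using k by (auto simp: x_def field_simps k_def)
    have x: "0 \<le> x" "x \<le> 1" using k by (auto simp: x_def divide_le_eq_1) (simp add: k_def)
    have "?h = (\<Sum>i<J. \<omega> * k\<^sup>2 * tent (knot J i) (knot J (Suc i)) x)"
      unfolding tent_def in_weight_def out_weight_def sx using \<omega> k
      by (intro sum.cong refl) (simp add: min_mult_distrib_left power2_eq_square mult_ac flip: k_def of_nat_add)
    then have h: "?h = \<omega> * k\<^sup>2 * (\<Sum>i<J. tent (knot J i) (knot J (Suc i)) x)"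
      by (simp add: sum_distrib_left)
    have g: "?g = \<omega> * k\<^sup>2 * (x * (1 - x))" by (simp add: sx power2_eq_square)
    have "0 \<le> \<omega> * k\<^sup>2" using \<omega> by simp
    from mult_left_mono[OF sum_tent_knot_bounds(1)[OF J x] this]
      mult_left_mono[OF sum_tent_knot_bounds(2)[OF J x] this]
    show ?thesis unfolding h g by (simp add: mult_ac)
  qed (simp add: in_weight_def)
  then show "?g \<le> ?h" "?h \<le> (1 + \<epsilon>) * ?g" by auto
qed

section \<open>Assembling the stars of all sets\<close>

text \<open>The condition of \<open>enumerates\<close> for an arbitrary node type, so that the
  existence statement and the program share one construction.\<close>

definition list_presentation :: "'a list list \<Rightarrow> 'a set set \<Rightarrow> bool" where
  "list_presentation cs C \<longleftrightarrow>
     distinct (map set cs) \<and> (\<forall>c\<in>set cs. distinct c) \<and> set ` set cs = C"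

lemma list_presentation_exists:
  assumes "finite C" "\<And>c. c \<in> C \<Longrightarrow> finite c"
  shows "\<exists>cs. list_presentation cs C"
proof -
  obtain Cs where Cs: "set Cs = C" "distinct Cs" using finite_distinct_list[OF assms(1)] by blast
  have "\<exists>l. set l = c \<and> distinct l" if "c \<in> C" for c
    using finite_distinct_list[OF assms(2)[OF that]] .
  then obtain l where l: "\<And>c. c \<in> C \<Longrightarrow> set (l c) = c \<and> distinct (l c)" by metis
  then have "map set (map l Cs) = Cs" using Cs by (auto simp: map_idI)
  then have "list_presentation (map l Cs) C"
    using Cs l by (simp add: list_presentation_def image_image)
  then show ?thesis ..
qed

lemma list_presentation_sum:
  fixes \<phi> :: "'a set \<Rightarrow> 'b::comm_monoid_add"
  assumes "list_presentation cs C"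
  shows "(\<Sum>r<length cs. \<phi> (set (cs ! r))) = (\<Sum>c\<in>C. \<phi> c)"
proof -
  have "(\<Sum>r<length cs. \<phi> (set (cs ! r))) = (\<Sum>c\<leftarrow>map set cs. \<phi> c)"
    by (simp add: sum_list_sum_nth atLeast0LessThan)
  also have "\<dots> = (\<Sum>c\<in>C. \<phi> c)"
    using assms sum_list_distinct_conv_sum_set[of "map set cs" \<phi>]
    by (simp add: list_presentation_def)
  finally show ?thesis .
qed

lemma list_presentation_length:
  assumes "list_presentation cs C" shows "length cs = card C"
  using list_presentation_sum[OF assms, of "\<lambda>_. 1::nat"] by simp

text \<open>The center for piece \<open>i\<close> of set \<open>r\<close> has number
  \<open>r * J + i\<close>. The naming \<open>aux\<close> of the centers is a parameter: fresh
  elements of an infinite type in one use, the numbers from \<open>n\<close> on in the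
  other.\<close>

definition sparsifier_list ::
  "(nat \<Rightarrow> 'a) \<Rightarrow> nat \<Rightarrow> ('a set \<Rightarrow> real) \<Rightarrow> 'a list list \<Rightarrow> ('a \<times> 'a \<times> real) list" where
  "sparsifier_list aux J w cs = concat (map (\<lambda>(r, i). star_edges (cs ! r) (aux (r * J + i))
       (in_weight J (length (cs ! r)) (w (set (cs ! r))) i)
       (out_weight J (length (cs ! r)) (w (set (cs ! r))) i))
     (List.product [0..<length cs] [0..<J]))"

lemma mixed_radix_inj: "inj_on (\<lambda>(r, i). r * J + i) (UNIV \<times> {..<J :: nat})"
proof (rule inj_onI, clarsimp)
  fix r i r' i' assume "r * J + i = r' * J + i'" "i < J" "i' < J"
  then show "r = r' \<and> i = i'"
    by (metis add.commute add_left_cancel div_mult_self3 div_less gr_implies_not_zero plus_nat.add_0)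
qed

lemma mixed_radix_less: "r < m \<Longrightarrow> i < J \<Longrightarrow> r * J + i < m * (J :: nat)"
  using mult_le_mono1[of "Suc r" m J] by simp

lemma mixed_radix_image: "(\<lambda>(r, i). r * J + i) ` ({..<m} \<times> {..<J}) = {..<m * (J :: nat)}"
proof
  show "{..<m * J} \<subseteq> (\<lambda>(r, i). r * J + i) ` ({..<m} \<times> {..<J})"
  proof
    fix j assume "j \<in> {..<m * J}"
    then have "j div J < m" "j mod J < J"
      by (auto simp: less_mult_imp_div_less) (metis mod_less_divisor mult_0_right not_gr0 not_less_zero)
    then show "j \<in> (\<lambda>(r, i). r * J + i) ` ({..<m} \<times> {..<J})"
      by (intro image_eqI[of _ _ "(j div J, j mod J)"]) auto
  qed
qed (auto intro: mixed_radix_less)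

text \<open>The stars have distinct centers, so the augmented cut is a sum of minima, one per set
  and piece. Grouped by set it is compared term by term, via \<open>clique_approximation\<close>,
  with the formula for the cut in \<open>cooc_cut_eq\<close>.\<close>

lemma sparsifier_list_correct:
  assumes inst: "cooccurrence_instance V C w" and cs: "list_presentation cs C"
    and inj: "inj_on aux {..<length cs * J}" and A: "A = aux ` {..<length cs * J}" "A \<inter> V = {}"
    and J: "J > 0" "16 \<le> \<epsilon> * (real J)\<^sup>2"
  defines "L \<equiv> sparsifier_list aux J w cs"
  shows "augmented_cut_sparsifier \<epsilon> V C w A (list_edges L) (list_weight L)"
proof -
  let ?I = "List.product [0..<length cs] [0..<J]"
  let ?z = "\<lambda>(r, i). aux (r * J + i)"
  let ?\<alpha> = "\<lambda>(r, i). in_weight J (length (cs ! r)) (w (set (cs ! r))) i"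
  let ?\<beta> = "\<lambda>(r, i). out_weight J (length (cs ! r)) (w (set (cs ! r))) i"
  have I: "set ?I = {..<length cs} \<times> {..<J}" by auto
  have z: "?z = aux \<circ> (\<lambda>(r, i). r * J + i)" by auto
  have zI: "?z ` set ?I = A" unfolding z I image_comp[symmetric] mixed_radix_image A ..
  have zinj: "inj_on ?z (set ?I)" unfolding z I
    by (rule comp_inj_on) (use inj mixed_radix_inj in \<open>auto simp: mixed_radix_image intro: inj_on_subset\<close>)
  have cV: "set (cs ! r) \<subseteq> V" and wpos: "0 < w (set (cs ! r))" and dist: "distinct (cs ! r)"
    if "r < length cs" for r
    using that cs inst unfolding list_presentation_def cooccurrence_instance_def
    by (metis Pow_iff imageI nth_mem subsetD)+
  have L: "L = concat (map (\<lambda>p. star_edges (cs ! fst p) (?z p) (?\<alpha> p) (?\<beta> p)) ?I)"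
    unfolding L_def sparsifier_list_def by (simp add: case_prod_unfold)
  \<comment> \<open>These two inequalities make the weights of all star edges nonnegative.\<close>
  have knot_sq: "(knot J i)\<^sup>2 \<le> (knot J (Suc i))\<^sup>2" "(1 - knot J (Suc i))\<^sup>2 \<le> (1 - knot J i)\<^sup>2"
    if "i < J" for i
    using knot_mono[of 0 i J] knot_mono[of i "Suc i" J] knot_mono[of "Suc i" J J] that J(1)
    by (auto intro!: power_mono)
  have digraph: "augmented_digraph V A (list_edges L) (list_weight L)"
    unfolding augmented_digraph_def
  proof (intro conjI ballI)
    have v: "v \<in> set (cs ! r) \<Longrightarrow> r < length cs \<Longrightarrow> v \<in> V" for v r using cV by auto
    have a: "aux (r * J + i) \<in> A" if "r < length cs" "i < J" for r i
      unfolding A using mixed_radix_less[OF that] by auto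
    show "list_edges L \<subseteq> (V \<union> A) \<times> (V \<union> A)"
      by (auto simp: list_edges_def L star_edges_def v a)
    have "0 \<le> rho" if "(u, v, rho) \<in> set L" for u v rho
      using that wpos knot_sq
      by (auto simp: L star_edges_def in_weight_def out_weight_def intro!: mult_nonneg_nonneg less_imp_le[OF wpos])
    then show "0 \<le> list_weight L e" for e
      unfolding list_weight_def by (intro sum_list_nonneg) auto
  qed (use A in auto)
  have "cooc_cut V C w S \<le> augmented_cut A (list_edges L) (list_weight L) S \<and>
      augmented_cut A (list_edges L) (list_weight L) S \<le> (1 + \<epsilon>) * cooc_cut V C w S" if S: "S \<subseteq> V" for S
  proof -
    define s s' where "s r = length (filter (\<lambda>v. v \<in> S) (cs ! r))"
      and "s' r = length (filter (\<lambda>v. v \<notin> S) (cs ! r))" for r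
    have len: "length (cs ! r) = s r + s' r" for r
      unfolding s_def s'_def by (simp add: sum_length_filter_compl)
    have "augmented_cut A (list_edges L) (list_weight L) S
        = (\<Sum>p\<leftarrow>?I. min (?\<alpha> p * s (fst p)) (?\<beta> p * s' (fst p)))"
      unfolding L s_def s'_def
      by (rule augmented_cut_stars[where V = V]) (use zinj zI A cV S in \<open>auto dest!: subsetD[OF cV]\<close>)
    also have "\<dots> = (\<Sum>p\<in>{..<length cs} \<times> {..<J}. min (?\<alpha> p * s (fst p)) (?\<beta> p * s' (fst p)))"
      by (subst sum_list_distinct_conv_sum_set) (simp_all only: I distinct_product distinct_upt)
    also have "\<dots> = (\<Sum>r<length cs. \<Sum>i<J. min (in_weight J (s r + s' r) (w (set (cs ! r))) i * s r)
        (out_weight J (s r + s' r) (w (set (cs ! r))) i * s' r))"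
      by (simp add: sum.cartesian_product case_prod_unfold len)
    finally have aug: "augmented_cut A (list_edges L) (list_weight L) S = \<dots>" .
    have "cooc_cut V C w S = (\<Sum>c\<in>C. w c * real (card (S \<inter> c)) * real (card ((V - S) \<inter> c)))"
      by (rule cooc_cut_eq[OF inst S])
    also have "\<dots> = (\<Sum>r<length cs. w (set (cs ! r)) * real (card (S \<inter> set (cs ! r)))
        * real (card ((V - S) \<inter> set (cs ! r))))"
      by (rule list_presentation_sum[OF cs, symmetric])
    also have "\<dots> = (\<Sum>r<length cs. w (set (cs ! r)) * real (s r) * real (s' r))"
    proof (intro sum.cong refl)
      fix r assume "r \<in> {..<length cs}"
      then have r: "r < length cs" by simp
      have "S \<inter> set (cs ! r) = set (filter (\<lambda>v. v \<in> S) (cs ! r))"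
        "(V - S) \<inter> set (cs ! r) = set (filter (\<lambda>v. v \<notin> S) (cs ! r))"
        using cV[OF r] by auto
      then show "w (set (cs ! r)) * real (card (S \<inter> set (cs ! r))) * real (card ((V - S) \<inter> set (cs ! r)))
          = w (set (cs ! r)) * real (s r) * real (s' r)"
        using dist[OF r] by (simp only: distinct_card distinct_filter s_def s'_def)
    qed
    finally have cut: "cooc_cut V C w S = \<dots>" .
    show ?thesis unfolding aug cut sum_distrib_left
      using wpos by (intro conjI sum_mono clique_approximation[OF J]) (auto intro: less_imp_le)
  qed
  then show ?thesis using digraph unfolding augmented_cut_sparsifier_def by blast
qed

section \<open>Counting edges, incidences and pieces\<close>

lemma length_sparsifier_list:
  "length (sparsifier_list aux J w cs) = 2 * J * (\<Sum>r<length cs. length (cs ! r))"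
proof -
  have "length (sparsifier_list aux J w cs)
      = (\<Sum>p\<leftarrow>List.product [0..<length cs] [0..<J]. 2 * length (cs ! fst p))"
    by (simp add: sparsifier_list_def length_concat comp_def case_prod_unfold)
  also have "\<dots> = (\<Sum>p\<in>{..<length cs} \<times> {..<J}. 2 * length (cs ! fst p))"
    by (subst sum_list_distinct_conv_sum_set)
      (simp_all add: distinct_product lessThan_atLeast0)
  also have "\<dots> = 2 * J * (\<Sum>r<length cs. length (cs ! r))"
    by (simp add: sum.cartesian_product' sum_distrib_left mult_ac)
  finally show ?thesis .
qed

text \<open>Double counting of the pairs of a node and a set containing it.\<close>

lemma sum_cooc_degree:
  assumes inst: "cooccurrence_instance V C w"
  shows "(\<Sum>c\<in>C. real (card c)) = real (card V) * avg_degree V C"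
proof (cases "V = {}")
  case True
  then have "C = {}" using inst by (auto simp: cooccurrence_instance_def)
  then show ?thesis by (simp add: True)
next
  case False
  have V: "finite V" "C \<subseteq> Pow V" using inst by (auto simp: cooccurrence_instance_def)
  then have C: "finite C" by (meson finite_Pow_iff finite_subset)
  have "(\<Sum>c\<in>C. card c) = (\<Sum>c\<in>C. card {v\<in>V. v \<in> c})"
    using V by (intro sum.cong refl arg_cong[where f = card]) auto
  also have "\<dots> = (\<Sum>v\<in>V. cooc_degree C v)"
    unfolding cooc_degree_def using sum.swap_restrict[OF C V(1), of "\<lambda>_ _. 1::nat" "\<lambda>c v. v \<in> c"]
    by simp
  finally have "(\<Sum>c\<in>C. card c) = (\<Sum>v\<in>V. cooc_degree C v)" .
  then have "(\<Sum>c\<in>C. real (card c)) = (\<Sum>v\<in>V. real (cooc_degree C v))"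
    by (simp flip: of_nat_sum)
  then show ?thesis using False V by (simp add: avg_degree_def)
qed

text \<open>For \<open>\<epsilon> > 0\<close> this is 4 / sqrt \<epsilon> rounded up. The form as a
  least number matches the counting loop by which the program finds it.\<close>

definition piece_count :: "real \<Rightarrow> nat" where
  "piece_count \<epsilon> = (LEAST J. J > 0 \<and> 16 \<le> \<epsilon> * (real J)\<^sup>2)"

lemma piece_count:
  assumes "\<epsilon> > 0"
  shows "piece_count \<epsilon> > 0" "16 \<le> \<epsilon> * (real (piece_count \<epsilon>))\<^sup>2"
    and piece_count_minimal: "\<And>J. J > 0 \<Longrightarrow> J < piece_count \<epsilon> \<Longrightarrow> \<epsilon> * (real J)\<^sup>2 < 16"
proof -
  \<comment> \<open>Any number above both 1 and \<open>16 / \<epsilon>\<close> will do, because then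
    \<open>\<epsilon> * J^2 \<ge> \<epsilon> * J \<ge> 16\<close>.\<close>
  obtain J :: nat where J: "max 1 (16 / \<epsilon>) < real J" using reals_Archimedean2 by blast
  have "16 \<le> \<epsilon> * real J" using J assms by (simp add: field_simps)
  also have "\<dots> \<le> \<epsilon> * (real J)\<^sup>2" using J assms by (simp add: power2_eq_square)
  finally have "J > 0 \<and> 16 \<le> \<epsilon> * (real J)\<^sup>2" using J by auto
  then have "piece_count \<epsilon> > 0 \<and> 16 \<le> \<epsilon> * (real (piece_count \<epsilon>))\<^sup>2"
    unfolding piece_count_def by (rule LeastI)
  then show "piece_count \<epsilon> > 0" "16 \<le> \<epsilon> * (real (piece_count \<epsilon>))\<^sup>2" by auto
  show "\<epsilon> * (real J)\<^sup>2 < 16" if "J > 0" "J < piece_count \<epsilon>" for J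
    using that not_less_Least[of J "\<lambda>J. J > 0 \<and> 16 \<le> \<epsilon> * (real J)\<^sup>2"]
    unfolding piece_count_def by auto
qed

text \<open>Below this value \<open>ln (ln (1 / \<epsilon>))\<close> exceeds 1.\<close>

definition accuracy_threshold :: real where "accuracy_threshold = exp (- exp 1)"

text \<open>By minimality the predecessor of the piece count is at most 4 / sqrt \<epsilon>, and the
  missing 1 is at most 1 / sqrt \<epsilon>. The iterated logarithm is at least 1 here, so
  multiplying by it preserves the bound.\<close>

lemma piece_count_le:
  assumes "\<epsilon> > 0" "\<epsilon> < accuracy_threshold"
  shows "real (piece_count \<epsilon>) \<le> 5 * sparsity_factor \<epsilon>"
proof -
  have "ln \<epsilon> < - exp 1" using assms unfolding accuracy_threshold_def
    by (metis exp_gt_zero ln_exp ln_less_cancel_iff)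
  then have "exp 1 \<le> ln (1 / \<epsilon>)" using assms by (simp add: ln_div)
  then have loglog: "1 \<le> ln (ln (1 / \<epsilon>))"
    by (metis exp_gt_zero ln_exp ln_le_cancel_iff less_le_trans)
  have "accuracy_threshold < 1" by (simp add: accuracy_threshold_def)
  then have eps: "\<epsilon> < 1" using assms by simp
  have root: "\<epsilon> powr (-1/2) = 1 / sqrt \<epsilon>"
    using assms powr_minus_divide[of \<epsilon> "1/2"] by (simp add: powr_half_sqrt)
  have sq: "0 < sqrt \<epsilon>" "sqrt \<epsilon> \<le> 1" using assms eps by auto
  have "real (piece_count \<epsilon>) - 1 \<le> 4 / sqrt \<epsilon>"
  proof (cases "piece_count \<epsilon> = 1")
    case False
    then have "\<epsilon> * (real (piece_count \<epsilon> - 1))\<^sup>2 < 16"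
      using piece_count(1)[OF assms(1)] by (intro piece_count_minimal assms) auto
    then have "(sqrt \<epsilon> * real (piece_count \<epsilon> - 1))\<^sup>2 < 4\<^sup>2"
      using assms by (simp add: power_mult_distrib)
    then have "sqrt \<epsilon> * real (piece_count \<epsilon> - 1) < 4" by (rule power2_less_imp_less) simp
    then show ?thesis using sq piece_count(1)[OF assms(1)] by (simp add: field_simps of_nat_diff)
  qed (use sq in simp)
  moreover have "1 \<le> 1 / sqrt \<epsilon>" using sq by simp
  ultimately have "real (piece_count \<epsilon>) \<le> 5 * (1 / sqrt \<epsilon>)" by simp
  also have "\<dots> \<le> 5 * (1 / sqrt \<epsilon> * ln (ln (1 / \<epsilon>)))"
    using loglog sq by (simp add: divide_right_mono)
  finally show ?thesis unfolding sparsity_factor_def root .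
qed

lemma sparsifier_exists:
  fixes V :: "'a::infinite set"
  assumes inst: "cooccurrence_instance V C w" and \<epsilon>: "\<epsilon> > 0"
  shows "\<exists>A E x. augmented_cut_sparsifier \<epsilon> V C w A E x \<and> 
    card (V \<union> A) \<le> card V + card C * piece_count \<epsilon> \<and>
    card E \<le> 2 * piece_count \<epsilon> * (\<Sum>c\<in>C. card c)"
proof -
  have V: "finite V" "C \<subseteq> Pow V" using inst by (auto simp: cooccurrence_instance_def)
  then have "finite C" "\<And>c. c \<in> C \<Longrightarrow> finite c"
    by (meson finite_Pow_iff finite_subset) (use V in \<open>auto intro: finite_subset\<close>)
  then obtain cs where cs: "list_presentation cs C" using list_presentation_exists by blast
  \<comment> \<open>The infinite type supplies fresh auxiliary nodes outside the finite
    \<open>V\<close>.\<close>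
  have "infinite (- V)" using V(1) infinite_UNIV by (metis Compl_eq_Diff_UNIV Diff_infinite_finite)
  then obtain aux :: "nat \<Rightarrow> 'a" where aux: "inj aux" "range aux \<subseteq> - V"
    using infinite_countable_subset by blast
  define J where "J = piece_count \<epsilon>"
  define A where "A = aux ` {..<length cs * J}"
  define L where "L = sparsifier_list aux J w cs"
  have "augmented_cut_sparsifier \<epsilon> V C w A (list_edges L) (list_weight L)"
    unfolding L_def
    by (rule sparsifier_list_correct[OF inst cs _ A_def])
      (use aux piece_count[OF \<epsilon>] in \<open>auto simp: J_def A_def intro: inj_on_subset\<close>)
  moreover have "card (V \<union> A) \<le> card V + card C * J"
    using card_Un_le[of V A] card_image_le[of "{..<length cs * J}" aux] list_presentation_length[OF cs]
    by (simp add: A_def)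
  moreover have "card (list_edges L) \<le> 2 * J * (\<Sum>c\<in>C. card c)"
  proof -
    have "(\<Sum>r<length cs. length (cs ! r)) = (\<Sum>r<length cs. card (set (cs ! r)))"
      using cs by (intro sum.cong refl) (auto simp: list_presentation_def distinct_card)
    also have "\<dots> = (\<Sum>c\<in>C. card c)" by (rule list_presentation_sum[OF cs])
    finally show ?thesis using card_list_edges_le[of L] by (simp add: L_def length_sparsifier_list)
  qed
  ultimately show ?thesis unfolding J_def by blast
qed

lemma sparsifier_size:
  "\<exists>K>0. \<exists>\<epsilon>0>0. \<forall>(V :: 'a::infinite set) C w. cooccurrence_instance V C w \<longrightarrow>
        (\<forall>\<epsilon>>0. \<exists>A E x. augmented_cut_sparsifier \<epsilon> V C w A E x \<and>
           (\<epsilon> < \<epsilon>0 \<longrightarrow>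
              real (card (V \<union> A)) \<le> K * (real (card V) + real (card C) * sparsity_factor \<epsilon>) \<and>
              real (card E) \<le> K * (real (card V) * avg_degree V C * sparsity_factor \<epsilon>)))"
\<comment> \<open>The constant is \<open>2 * 5\<close>: two edges per member and piece, times the
  constant of \<open>piece_count_le\<close>.\<close>
proof (rule exI[of _ 10], intro conjI exI[of _ accuracy_threshold] allI impI)
  fix V :: "'a set" and C w and \<epsilon> :: real
  assume inst: "cooccurrence_instance V C w" and \<epsilon>: "0 < \<epsilon>"
  obtain A E x where S: "augmented_cut_sparsifier \<epsilon> V C w A E x"
    and nodes: "card (V \<union> A) \<le> card V + card C * piece_count \<epsilon>"
    and edges: "card E \<le> 2 * piece_count \<epsilon> * (\<Sum>c\<in>C. card c)"
    using sparsifier_exists[OF inst \<epsilon>] by blast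
  have "real (card (V \<union> A)) \<le> 10 * (real (card V) + real (card C) * sparsity_factor \<epsilon>) \<and>
      real (card E) \<le> 10 * (real (card V) * avg_degree V C * sparsity_factor \<epsilon>)" if "\<epsilon> < accuracy_threshold"
  proof
    note J = piece_count_le[OF \<epsilon> that]
    have "real (card (V \<union> A)) \<le> real (card V) + real (card C) * real (piece_count \<epsilon>)"
      using nodes by (simp flip: of_nat_mult of_nat_add)
    also have "\<dots> \<le> 10 * real (card V) + real (card C) * (10 * sparsity_factor \<epsilon>)"
      using J by (intro add_mono mult_left_mono) auto
    finally show "real (card (V \<union> A)) \<le> 10 * (real (card V) + real (card C) * sparsity_factor \<epsilon>)"
      by (simp add: algebra_simps)
    have "real (card E) \<le> 2 * real (piece_count \<epsilon>) * (\<Sum>c\<in>C. real (card c))"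
      using edges by (simp flip: of_nat_mult of_nat_sum) (metis of_nat_le_iff of_nat_mult of_nat_numeral)
    also have "\<dots> \<le> 2 * (5 * sparsity_factor \<epsilon>) * (\<Sum>c\<in>C. real (card c))"
      using J by (intro mult_right_mono mult_left_mono sum_nonneg) auto
    finally show "real (card E) \<le> 10 * (real (card V) * avg_degree V C * sparsity_factor \<epsilon>)"
      unfolding sum_cooc_degree[OF inst] by (simp add: mult_ac)
  qed
  with S show "\<exists>A E x. augmented_cut_sparsifier \<epsilon> V C w A E x \<and>
           (\<epsilon> < accuracy_threshold \<longrightarrow>
              real (card (V \<union> A)) \<le> 10 * (real (card V) + real (card C) * sparsity_factor \<epsilon>) \<and>
              real (card E) \<le> 10 * (real (card V) * avg_degree V C * sparsity_factor \<epsilon>))"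
    by blast
qed (simp_all add: accuracy_threshold_def)

subsection \<open>The program\<close>

text \<open>A total correctness calculus; the postcondition also sees the number of steps.\<close>

definition wp :: "com \<Rightarrow> (nat \<Rightarrow> state \<Rightarrow> bool) \<Rightarrow> state \<Rightarrow> bool" where
  "wp p Q s \<longleftrightarrow> (\<exists>t s'. exec p s t s' \<and> Q t s')"

lemma wp_Seq: "wp p (\<lambda>t s'. wp q (\<lambda>t'. Q (t + t')) s') s \<Longrightarrow> wp (Seq p q) Q s"
  unfolding wp_def using exec_Seq by blast

lemma wp_NAssign:
  "Q (1 + ncost a) (s\<lparr>nvar := (nvar s)(i := nval a s)\<rparr>) \<Longrightarrow> wp (NAssign i a) Q s"
  unfolding wp_def using exec_NAssign by blast

lemma wp_RAssign:
  "Q (1 + rcost r) (s\<lparr>rvar := (rvar s)(i := rval r s)\<rparr>) \<Longrightarrow> wp (RAssign i r) Q s"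
  unfolding wp_def using exec_RAssign by blast

lemma wp_Emit:
  "Q (1 + ncost a + ncost b + rcost r)
    (s\<lparr>emitted := emitted s @ [(nval a s, nval b s, rval r s)]\<rparr>) \<Longrightarrow> wp (Emit a b r) Q s"
  unfolding wp_def using exec_Emit by blast

lemmas wp_simple = wp_Seq wp_NAssign wp_RAssign wp_Emit

text \<open>A rule for loops whose number \<open>m\<close> of passes is known in advance:
  \<open>I i\<close> holds before pass \<open>i\<close>, and \<open>B i\<close> bounds the cost of
  its body. The last summand pays for the final, failing test of the guard.\<close>

lemma wp_Loop:
  assumes "I 0 s"
    and step: "\<And>i s. i < m \<Longrightarrow> I i s \<Longrightarrow> bval b s \<and> wp p (\<lambda>t s'. t \<le> B i \<and> I (Suc i) s') s"
    and exit: "\<And>s. I m s \<Longrightarrow> \<not> bval b s"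
    and post: "\<And>t s'. t \<le> (\<Sum>i<m. 1 + bcost b + B i) + (1 + bcost b) \<Longrightarrow> I m s' \<Longrightarrow> Q t s'"
  shows "wp (Loop b p) Q s"
proof -
  \<comment> \<open>The run from pass \<open>k\<close> onwards is built by induction downwards from
    \<open>m\<close>.\<close>
  have "\<exists>t s'. exec (Loop b p) s t s' \<and> t \<le> (\<Sum>i\<in>{k..<m}. 1 + bcost b + B i) + (1 + bcost b) \<and> I m s'"
    if "k \<le> m" "I k s" for k s
    using that
  proof (induction arbitrary: s rule: inc_induct)
    case base
    then show ?case using exec_LoopF[OF exit] by (metis add_0 atLeastLessThan_empty le_refl sum.empty)
  next
    case (step k)
    obtain t s' where t: "bval b s" "exec p s t s'" "t \<le> B k" "I (Suc k) s'"
      using assms(2)[OF step.hyps(2) step.prems] unfolding wp_def by blast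
    obtain t' s'' where t': "exec (Loop b p) s' t' s''" "I m s''"
      "t' \<le> (\<Sum>i\<in>{Suc k..<m}. 1 + bcost b + B i) + (1 + bcost b)"
      using step.IH[OF t(4)] by blast
    have "exec (Loop b p) s (1 + bcost b + t + t') s''"
      by (rule exec_LoopT) (use t t' in auto)
    moreover have "1 + bcost b + t + t' \<le> (\<Sum>i\<in>{k..<m}. 1 + bcost b + B i) + (1 + bcost b)"
      using t(3) t'(3) sum.atLeast_Suc_lessThan[OF step.hyps(2), of "\<lambda>i. 1 + bcost b + B i"] by linarith
    ultimately show ?case using t'(2) by blast
  qed
  from this[of 0 s] assms(1) show ?thesis
    unfolding wp_def atLeast0LessThan using post by blast
qed

text \<open>
  Natural number variables of the program: 0 next free node, 2 number of pieces, 3 current set,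
  4 address of its block or of its first member, 5 current piece, 6 current position in the set,
  7 size of the set, 8 current member.  Real variables 1 and 2 hold two consecutive knots, 3 and 4
  the weights of the edges into and out of the center.
\<close>

definition emit_star :: com where
  "emit_star = Loop (NLess (NVar 6) (NVar 7))
     (Seq (NAssign 8 (NMem (NAdd (NVar 4) (NVar 6))))
     (Seq (Emit (NVar 8) (NVar 0) (RVar 3))
     (Seq (Emit (NVar 0) (NVar 8) (RVar 4))
       (NAssign 6 (NAdd (NVar 6) (NConst 1))))))"

lemma emit_star:
  assumes "nvar s 6 = 0" "nvar s 7 = length c"
    and c: "\<And>j. j < length c \<Longrightarrow> nmem s (nvar s 4 + j) = c ! j"
    and Q: "\<And>t s'. t \<le> 25 * length c + 5 \<Longrightarrow> nmem s' = nmem s \<Longrightarrow> rmem s' = rmem s \<Longrightarrow> rvar s' = rvar s \<Longrightarrow>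
      (\<And>v. v \<noteq> 6 \<Longrightarrow> v \<noteq> 8 \<Longrightarrow> nvar s' v = nvar s v) \<Longrightarrow>
      emitted s' = emitted s @ star_edges c (nvar s 0) (rvar s 3) (rvar s 4) \<Longrightarrow> Q t s'"
  shows "wp emit_star Q s"
  unfolding emit_star_def
\<comment> \<open>The body takes 17 steps and the guard 4; the constants 20 and 25 leave
  room.\<close>
proof (rule wp_Loop[where m = "length c" and B = "\<lambda>_. 20" and
      I = "\<lambda>j s'. nmem s' = nmem s \<and> rmem s' = rmem s \<and> rvar s' = rvar s \<and>
        (\<forall>v. v \<noteq> 6 \<longrightarrow> v \<noteq> 8 \<longrightarrow> nvar s' v = nvar s v) \<and> nvar s' 6 = j \<and>
        emitted s' = emitted s @ star_edges (take j c) (nvar s 0) (rvar s 3) (rvar s 4)"], goal_cases)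
  case (2 j s')
  then show ?case
    using assms
    by (auto intro!: wp_simple simp: star_edges_def take_Suc_conv_app_nth)
next
  case (4 t s')
  then show ?case by (intro Q) auto
qed (use assms in \<open>auto simp: star_edges_def\<close>)

text \<open>Variable 2 holds the number of pieces, and the truncated \<open>NSub\<close> agrees with
  the subtraction in \<open>knot\<close>, so the value is right in every state.\<close>

definition knot_exp :: "nexp \<Rightarrow> rexp" where
  "knot_exp a = RDiv (RMul (ROfNat a) (ROfNat a))
     (RAdd (RMul (ROfNat a) (ROfNat a))
       (RMul (ROfNat (NSub (NVar 2) a)) (ROfNat (NSub (NVar 2) a))))"

lemma rval_knot_exp [simp]: "rval (knot_exp a) s = knot (nvar s 2) (nval a s)"
  by (simp add: knot_exp_def knot_def)

lemma rcost_knot_exp [simp]: "rcost (knot_exp a) = 15 + 6 * ncost a"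
  by (simp add: knot_exp_def)

definition square_exp :: "rexp \<Rightarrow> rexp" where
  "square_exp r = RMul r r"

lemma square_exp_simps [simp]:
  "rval (square_exp r) s = (rval r s)\<^sup>2" "rcost (square_exp r) = 1 + 2 * rcost r"
  by (simp_all add: square_exp_def power2_eq_square)

text \<open>One pattern for both star weights: a difference of squares, taken of the complements of
  the knots for incoming edges and of the knots for outgoing ones.\<close>

definition weight_exp :: "rexp \<Rightarrow> rexp \<Rightarrow> rexp" where
  "weight_exp a b = RMul (RMul (ROfNat (NVar 7)) (RMem (NVar 3))) (RSub (square_exp a) (square_exp b))"

lemma weight_exp_simps [simp]:
  "rval (weight_exp a b) s = real (nvar s 7) * rmem s (nvar s 3) * ((rval a s)\<^sup>2 - (rval b s)\<^sup>2)"
  "rcost (weight_exp a b) = 9 + 2 * rcost a + 2 * rcost b"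
  by (simp_all add: weight_exp_def)

definition emit_set :: com where
  "emit_set = Loop (NLess (NVar 5) (NVar 2))
     (Seq (RAssign 1 (knot_exp (NVar 5)))
     (Seq (RAssign 2 (knot_exp (NAdd (NVar 5) (NConst 1))))
     (Seq (RAssign 3 (weight_exp (RSub (RConst 1) (RVar 1)) (RSub (RConst 1) (RVar 2))))
     (Seq (RAssign 4 (weight_exp (RVar 2) (RVar 1)))
     (Seq (NAssign 6 (NConst 0))
     (Seq emit_star
     (Seq (NAssign 0 (NAdd (NVar 0) (NConst 1)))
       (NAssign 5 (NAdd (NVar 5) (NConst 1))))))))))"

lemma emit_set:
  assumes "nvar s 5 = 0" "nvar s 7 = length c"
    and c: "\<And>j. j < length c \<Longrightarrow> nmem s (nvar s 4 + j) = c ! j"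
    and Q: "\<And>t s'. t \<le> nvar s 2 * (25 * length c + 200) + 5 \<Longrightarrow> nmem s' = nmem s \<Longrightarrow> rmem s' = rmem s \<Longrightarrow>
      rvar s' 0 = rvar s 0 \<Longrightarrow> (\<And>v. v \<in> {1, 2, 3, 4, 7} \<Longrightarrow> nvar s' v = nvar s v) \<Longrightarrow>
      nvar s' 0 = nvar s 0 + nvar s 2 \<Longrightarrow>
      emitted s' = emitted s @ concat (map (\<lambda>i. star_edges c (nvar s 0 + i)
        (in_weight (nvar s 2) (length c) (rmem s (nvar s 3)) i)
        (out_weight (nvar s 2) (length c) (rmem s (nvar s 3)) i)) [0..<nvar s 2]) \<Longrightarrow> Q t s'"
  shows "wp emit_set Q s"
  unfolding emit_set_def
\<comment> \<open>A pass takes at most \<open>25 * length c + 107\<close> steps, including the inner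
  loop, and 4 more for the guard; the constants are rounded up. Variable 0 moves on by one center
  per pass.\<close>
proof (rule wp_Loop[where m = "nvar s 2" and B = "\<lambda>_. 25 * length c + 190" and
      I = "\<lambda>i s'. nmem s' = nmem s \<and> rmem s' = rmem s \<and> rvar s' 0 = rvar s 0 \<and>
        (\<forall>v\<in>{1, 2, 3, 4, 7}. nvar s' v = nvar s v) \<and> nvar s' 0 = nvar s 0 + i \<and> nvar s' 5 = i \<and>
        emitted s' = emitted s @ concat (map (\<lambda>i. star_edges c (nvar s 0 + i)
          (in_weight (nvar s 2) (length c) (rmem s (nvar s 3)) i)
          (out_weight (nvar s 2) (length c) (rmem s (nvar s 3)) i)) [0..<i])"], goal_cases)
  case (2 i s')
  show ?case
    apply (rule conjI)
    using 2 apply simp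
    apply (intro wp_simple)
    apply (rule emit_star[where c = c])
    using 2 assms(1,2) c apply simp_all
    apply (intro wp_simple)
    apply (simp add: in_weight_def out_weight_def)
    done
next
  case (4 t s')
  then show ?case by (intro Q) (auto simp: algebra_simps)
qed (use assms in auto)

text \<open>The first loop finds the number of pieces by counting up, in place of a root and
  rounding. The second one walks through the blocks of the input; variable 3 serves both as counter
  of the sets and as address of their weights, and like variable 4 it starts at 0.\<close>

definition sparsify :: com where
  "sparsify = Seq (NAssign 2 (NConst 1))
     (Seq (Loop (RLess (RMul (RVar 0) (square_exp (ROfNat (NVar 2)))) (RConst 16))
       (NAssign 2 (NAdd (NVar 2) (NConst 1))))
     (Loop (NLess (NVar 3) (NVar 1))
       (Seq (NAssign 7 (NMem (NVar 4)))
       (Seq (NAssign 4 (NAdd (NVar 4) (NConst 1)))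
       (Seq (NAssign 5 (NConst 0))
       (Seq emit_set
       (Seq (NAssign 4 (NAdd (NVar 4) (NVar 7)))
         (NAssign 3 (NAdd (NVar 3) (NConst 1))))))))))"

lemma nth_concat_offset:
  assumes "r < length xss" "j < length (xss ! r)"
  shows "(\<Sum>i<r. length (xss ! i)) + j < length (concat xss)"
    and "concat xss ! ((\<Sum>i<r. length (xss ! i)) + j) = xss ! r ! j"
proof -
  have "(\<Sum>i<r. length (xss ! i)) + j < length (concat xss) \<and>
      concat xss ! ((\<Sum>i<r. length (xss ! i)) + j) = xss ! r ! j"
    using assms
  proof (induction xss arbitrary: r)
    case (Cons xs xss)
    then show ?case
      by (cases r) (auto simp: nth_append sum.lessThan_Suc_shift simp del: sum.lessThan_Suc)
  qed simp
  then show "(\<Sum>i<r. length (xss ! i)) + j < length (concat xss)"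
    "concat xss ! ((\<Sum>i<r. length (xss ! i)) + j) = xss ! r ! j" by auto
qed

lemma concat_map_product:
  "concat (map f (List.product xs ys)) = concat (map (\<lambda>x. concat (map (\<lambda>y. f (x, y)) ys)) xs)"
  by (induction xs) (simp_all add: comp_def)

text \<open>The step of the invariant for the outer loop: processing one more set appends its stars,
  and the earlier centers keep their numbers.\<close>

lemma sparsifier_list_append_set:
  assumes "r < length cs"
  shows "sparsifier_list aux J w (take (Suc r) cs) = sparsifier_list aux J w (take r cs) @
    concat (map (\<lambda>i. star_edges (cs ! r) (aux (r * J + i))
       (in_weight J (length (cs ! r)) (w (set (cs ! r))) i)
       (out_weight J (length (cs ! r)) (w (set (cs ! r))) i)) [0..<J])"
proof -
  have L: "sparsifier_list aux J w (take m cs) = concat (map (\<lambda>r. concat (map (\<lambda>i. star_edges (cs ! r) (aux (r * J + i))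
       (in_weight J (length (cs ! r)) (w (set (cs ! r))) i)
       (out_weight J (length (cs ! r)) (w (set (cs ! r))) i)) [0..<J])) [0..<m])" if "m \<le> length cs" for m
    using that unfolding sparsifier_list_def
    by (simp add: concat_map_product min_absorb2)
      (rule arg_cong[where f = concat], rule map_cong[OF refl], simp)
  show ?thesis using assms by (simp add: L)
qed

lemma sparsify:
  assumes \<epsilon>: "\<epsilon> > 0"
  defines "J \<equiv> piece_count \<epsilon>"
  shows "\<exists>t s. exec sparsify (input_state n cs w \<epsilon>) t s \<and>
    t \<le> 20 * J + (\<Sum>r<length cs. J * (25 * length (cs ! r) + 200) + 50) \<and>
    nvar s 0 = n + length cs * J \<and> emitted s = sparsifier_list (\<lambda>m. n + m) J w cs"
proof -
  let ?s = "input_state n cs w \<epsilon>"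
  \<comment> \<open>The address of the size cell of set \<open>r\<close>; each earlier set occupies
    one cell more than it has members.\<close>
  define off where "off r = (\<Sum>i<r. Suc (length (cs ! i)))" for r
  have off_Suc: "off (Suc r) = off r + Suc (length (cs ! r))" for r by (simp add: off_def)
  have off_conv: "off r = (\<Sum>i<r. length (map (\<lambda>c. length c # c) cs ! i))" if "r < length cs" for r
    unfolding off_def using that by (intro sum.cong) auto
  have mem: "nmem ?s (off r + j) = (length (cs ! r) # cs ! r) ! j"
    if "r < length cs" "j \<le> length (cs ! r)" for r j
    using nth_concat_offset[of r "map (\<lambda>c. length c # c) cs" j] that
    by (simp add: input_state_def mem_of_list_def off_conv)
  have mem0: "nmem ?s (off r) = length (cs ! r)" if "r < length cs" for r
    using mem[OF that, of 0] by simp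
  have memS: "nmem ?s (Suc (off r + j)) = cs ! r ! j" if "r < length cs" "j < length (cs ! r)" for r j
    using mem[OF that(1), of "Suc j"] that(2) by simp
  have rmem: "rmem ?s r = w (set (cs ! r))" if "r < length cs" for r
    using that by (simp add: input_state_def mem_of_list_def)
  note J = piece_count[OF \<epsilon>, folded J_def] piece_count_minimal[OF \<epsilon>, folded J_def]
  have "wp sparsify (\<lambda>t s. t \<le> 20 * J + (\<Sum>r<length cs. J * (25 * length (cs ! r) + 200) + 50) \<and>
    nvar s 0 = n + length cs * J \<and> emitted s = sparsifier_list (\<lambda>m. n + m) J w cs) ?s"
    unfolding sparsify_def
  \<comment> \<open>The search starts at 1 and so makes \<open>J - 1\<close> passes. Minimality of
    \<open>J\<close> keeps the guard true before, and the defining inequality of \<open>J\<close>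
    makes it fail at the end.\<close>
  proof (intro wp_Seq wp_NAssign, rule wp_Loop[where m = "J - 1" and B = "\<lambda>_. 4" and
      I = "\<lambda>i s. s = ?s\<lparr>nvar := (nvar ?s)(2 := Suc i)\<rparr>"], goal_cases)
    case (2 i s)
    then show ?case using J(3)[of "Suc i"]
      by (auto intro!: wp_NAssign simp: input_state_def)
  next
    case (3 s)
    then show ?case using J(1,2) by (auto simp: input_state_def)
  next
    case (4 t s)
    show ?case
    proof (rule wp_Loop[where m = "length cs" and B = "\<lambda>r. J * (25 * length (cs ! r) + 200) + 40" and
      I = "\<lambda>r s. nmem s = nmem ?s \<and> rmem s = rmem ?s \<and> nvar s 1 = length cs \<and> nvar s 2 = J \<and>
        nvar s 3 = r \<and> nvar s 4 = off r \<and> nvar s 0 = n + r * J \<and>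
        emitted s = sparsifier_list (\<lambda>m. n + m) J w (take r cs)"], goal_cases)
      case 1
      then show ?case using 4 J(1) by (simp add: input_state_def off_def sparsifier_list_def)
    next
      case (2 r s)
      then have r: "r < length cs" by simp
      show ?case
        apply (rule conjI)
        using 2 apply simp
        apply (intro wp_simple)
        apply (rule emit_set[where c = "cs ! r"])
        using 2 mem0[OF r] memS[OF r] apply simp_all
        apply (intro wp_simple)
        apply (simp add: off_Suc rmem[OF r] sparsifier_list_append_set[OF r] add.assoc)
        done
    next
      case (3 s)
      then show ?case by simp
    next
      case (4 t' s')
      \<comment> \<open>The 6 steps are the initial assignment and the final test of the outer loop.
        A pass of the search costs 14 steps, its last test 10.\<close>
      have "t + 6 \<le> 20 * J" using \<open>t \<le> (\<Sum>i<J - 1. _) + _\<close> J(1) by simp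
      moreover have "(\<Sum>r<length cs. 44 + J * (25 * length (cs ! r) + 200))
          \<le> (\<Sum>r<length cs. J * (25 * length (cs ! r) + 200) + 50)"
        by (intro sum_mono) simp
      ultimately show ?case using 4 by simp
    qed
  qed (simp add: input_state_def)
  then show ?thesis unfolding wp_def .
qed

subsection \<open>Running times\<close>

text \<open>Every step emits at most one edge, so the size of the output bounds the time from
  below.\<close>

lemma length_emitted_le:
  "exec p s t s' \<Longrightarrow> length (emitted s') \<le> length (emitted s) + t"
  by (induction rule: exec.induct) auto

text \<open>A set of size \<open>k\<close> forces \<open>k choose 2\<close> emitted edges, with
  multiplicity across the sets, and \<open>k^2 = 2 * (k choose 2) + k\<close>.\<close>

lemma sum_card_squares_le:
  assumes forms: "forms_explicitly Q n C w t" and inst: "cooccurrence_instance {..<n} C w"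
  shows "(\<Sum>c\<in>C. real (card c) ^ 2) \<le> 2 * real t + (\<Sum>c\<in>C. real (card c))"
proof -
  obtain cs s where s: "exec Q (input_state n cs w 0) t s" "places_cliques C w s"
    using forms unfolding forms_explicitly_def by blast
  have fin: "finite c" if "c \<in> C" for c
    using that inst unfolding cooccurrence_instance_def by (meson Pow_iff finite_lessThan finite_subset subsetD)
  have "length (emitted s) = size (image_mset (\<lambda>(u, v, r). ({u, v}, r)) (mset (emitted s)))" by simp
  also have "\<dots> = (\<Sum>c\<in>C. card {e. e \<subseteq> c \<and> card e = 2})"
    using s(2) unfolding places_cliques_def by simp
  also have "\<dots> = (\<Sum>c\<in>C. card c choose 2)"
    by (intro sum.cong refl n_subsets fin)
  finally have "(\<Sum>c\<in>C. card c choose 2) \<le> t"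
    using length_emitted_le[OF s(1)] by (simp add: input_state_def)
  then have "(\<Sum>c\<in>C. real (card c choose 2)) \<le> real t" by (simp flip: of_nat_sum)
  moreover have "real k ^ 2 = 2 * real (k choose 2) + real k" for k
  proof -
    have "even (k * (k - 1))" by (cases k) auto
    then have "2 * (k choose 2) = k * (k - 1)" by (simp add: choose_two)
    then have "k ^ 2 = 2 * (k choose 2) + k" by (cases k) (auto simp: power2_eq_square)
    then show ?thesis by (metis of_nat_add of_nat_mult of_nat_numeral of_nat_power)
  qed
  ultimately show ?thesis by (simp add: sum.distrib flip: sum_distrib_left)
qed

text \<open>The linear term \<open>n * d\<close> is eventually at most half of
  \<open>c * n powr (1 + \<delta>)\<close>. The other half bounds \<open>2 * T\<close> from below,
  which gives the constant \<open>c / 4\<close>.\<close>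

lemma explicit_time_lower_bound:
  fixes n :: "nat \<Rightarrow> nat" and f T :: "nat \<Rightarrow> real"
  assumes n: "filterlim n at_top sequentially" and \<delta>: "\<delta> > 0"
    and f: "f \<in> \<Omega>(\<lambda>k. real (n k) powr (1 + \<delta>))"
    and f0: "\<And>k. 0 \<le> f k" and T: "\<And>k. f k \<le> 2 * T k + real (n k) * d"
  shows "T \<in> \<Omega>(\<lambda>k. real (n k) powr (1 + \<delta>))"
proof -
  obtain c where c: "c > 0" "\<forall>\<^sub>F k in sequentially. c * norm (real (n k) powr (1 + \<delta>)) \<le> norm (f k)"
    using f unfolding bigomega_def by blast
  \<comment> \<open>Once \<open>n \<ge> M powr (1 / \<delta>)\<close>, the power
    \<open>n powr \<delta>\<close> is at least \<open>2 * \<bar>d\<bar> / c\<close>. The lower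
    bounds 1 keep the bases of the powers positive.\<close>
  define M where "M = max 1 (2 * \<bar>d\<bar> / c)"
  define X where "X = nat \<lceil>max 1 (M powr (1 / \<delta>))\<rceil>"
  have "\<forall>\<^sub>F k in sequentially. X \<le> n k" using n by (simp add: filterlim_at_top)
  with c(2) have "\<forall>\<^sub>F k in sequentially. c / 4 * norm (real (n k) powr (1 + \<delta>)) \<le> norm (T k)"
  proof eventually_elim
    case (elim k)
    have n: "1 \<le> real (n k)" "M powr (1 / \<delta>) \<le> real (n k)" using elim(2) unfolding X_def by linarith+
    have "M = (M powr (1 / \<delta>)) powr \<delta>" using \<delta> by (simp add: powr_powr M_def)
    also have "\<dots> \<le> real (n k) powr \<delta>" using n \<delta> by (intro powr_mono2) auto
    finally have "2 * \<bar>d\<bar> / c \<le> real (n k) powr \<delta>" by (simp add: M_def)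
    then have "2 * \<bar>d\<bar> \<le> c * real (n k) powr \<delta>" using c(1) by (simp add: field_simps)
    then have "real (n k) * (2 * \<bar>d\<bar>) \<le> real (n k) * (c * real (n k) powr \<delta>)"
      by (intro mult_left_mono) auto
    also have "\<dots> = c * real (n k) powr (1 + \<delta>)" using n by (simp add: powr_add)
    finally have lower: "2 * (real (n k) * \<bar>d\<bar>) \<le> c * real (n k) powr (1 + \<delta>)" by simp
    have "real (n k) * d \<le> real (n k) * \<bar>d\<bar>" by (intro mult_left_mono) auto
    moreover have "c * real (n k) powr (1 + \<delta>) \<le> f k" using elim(1) f0[of k] by simp
    ultimately have "c / 4 * real (n k) powr (1 + \<delta>) \<le> T k" using T[of k] lower by simp
    then show ?case by simp
  qed
  then show ?thesis using c(1) unfolding bigomega_def by (auto intro!: exI[of _ "c / 4"])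
qed

section \<open>Size and running time of the computed sparsifier\<close>

lemma sparsify_correct:
  assumes inst: "cooccurrence_instance {..<n} C w" and enum: "enumerates cs C" and \<epsilon>: "\<epsilon> > 0"
  shows "\<exists>t s. exec sparsify (input_state n cs w \<epsilon>) t s \<and>
    augmented_cut_sparsifier \<epsilon> {..<n} C w (output_nodes s - {..<n}) (output_edges s) (output_weight s) \<and>
    card ({..<n} \<union> output_nodes s) \<le> n + piece_count \<epsilon> * (\<Sum>c\<in>C. card c) \<and>
    card (output_edges s) \<le> 2 * piece_count \<epsilon> * (\<Sum>c\<in>C. card c) \<and>
    t \<le> piece_count \<epsilon> * (20 + 275 * (\<Sum>c\<in>C. card c))"
proof -
  define J where "J = piece_count \<epsilon>"
  note J = piece_count(1,2)[OF \<epsilon>, folded J_def]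
  have cs: "list_presentation cs C" using enum by (simp add: enumerates_def list_presentation_def)
  obtain t s where exec: "exec sparsify (input_state n cs w \<epsilon>) t s"
    and t: "t \<le> 20 * J + (\<Sum>r<length cs. J * (25 * length (cs ! r) + 200) + 50)"
    and N: "nvar s 0 = n + length cs * J" and L: "emitted s = sparsifier_list (\<lambda>m. n + m) J w cs"
    using sparsify[OF \<epsilon>] unfolding J_def by blast
  have edges: "output_edges s = list_edges (emitted s)"
    by (simp add: output_edges_def list_edges_def)
  have weight: "output_weight s = list_weight (emitted s)"
    by (rule ext) (simp add: output_weight_def list_weight_def)
  have card_nth: "length (cs ! r) = card (set (cs ! r))" if "r < length cs" for r
    using that cs by (simp add: list_presentation_def distinct_card)
  have lens: "(\<Sum>r<length cs. length (cs ! r)) = (\<Sum>c\<in>C. card c)"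
    using list_presentation_sum[OF cs, of card] card_nth by simp
  \<comment> \<open>As all sets are nonempty, the number of sets and the fixed cost per set can be
    charged to their members.\<close>
  have pos: "1 \<le> length (cs ! r)" if "r < length cs" for r
  proof -
    have "set (cs ! r) \<in> C" using that cs by (auto simp: list_presentation_def)
    then have "set (cs ! r) \<noteq> {}" using inst by (metis cooccurrence_instance_def)
    then show ?thesis by (cases "cs ! r") auto
  qed
  have "(\<lambda>m. n + m) ` {..<length cs * J} = {n..<n + length cs * J}"
    using image_add_atLeastLessThan[of n 0 "length cs * J"] by (simp add: atLeast0LessThan add.commute)
  then have A: "output_nodes s - {..<n} = (\<lambda>m. n + m) ` {..<length cs * J}"
    by (auto simp: output_nodes_def N)
  have "augmented_cut_sparsifier \<epsilon> {..<n} C w (output_nodes s - {..<n}) (output_edges s) (output_weight s)"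
    unfolding edges weight L
    by (rule sparsifier_list_correct[OF inst cs _ A _ J]) auto
  moreover have "card ({..<n} \<union> output_nodes s) \<le> n + J * (\<Sum>c\<in>C. card c)"
  proof -
    have "{..<n} \<union> output_nodes s = {..<n + length cs * J}" by (auto simp: output_nodes_def N)
    moreover have "length cs \<le> (\<Sum>r<length cs. length (cs ! r))"
      using sum_mono[of "{..<length cs}" "\<lambda>_. 1" "\<lambda>r. length (cs ! r)"] pos by simp
    ultimately show ?thesis by (simp add: lens mult.commute)
  qed
  moreover have "card (output_edges s) \<le> 2 * J * (\<Sum>c\<in>C. card c)"
    using card_list_edges_le[of "emitted s"] by (simp add: edges L length_sparsifier_list lens)
  moreover have "t \<le> J * (20 + 275 * (\<Sum>c\<in>C. card c))"
  proof -
    \<comment> \<open>The constant is \<open>25 + 200 + 50\<close>, using that \<open>J\<close> and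
      the size of the set are at least 1.\<close>
    have "J * (25 * length (cs ! r) + 200) + 50 \<le> 275 * J * length (cs ! r)" if "r < length cs" for r
    proof -
      have "J * 1 \<le> J * length (cs ! r)" by (rule mult_le_mono2) (rule pos[OF that])
      moreover have "J * (25 * length (cs ! r) + 200) = 25 * (J * length (cs ! r)) + 200 * J"
        "275 * J * length (cs ! r) = 275 * (J * length (cs ! r))" by (simp_all add: algebra_simps)
      ultimately show ?thesis using J(1) by linarith
    qed
    then have "(\<Sum>r<length cs. J * (25 * length (cs ! r) + 200) + 50) \<le> (\<Sum>r<length cs. 275 * J * length (cs ! r))"
      by (intro sum_mono) simp
    also have "\<dots> = 275 * J * (\<Sum>c\<in>C. card c)" by (simp only: lens flip: sum_distrib_left)
    finally show ?thesis using t by (simp add: algebra_simps)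
  qed
  ultimately show ?thesis using exec unfolding J_def by blast
qed

lemma sparsify_resources:
  assumes inst: "cooccurrence_instance {..<n} C w" and enum: "enumerates cs C" and \<epsilon>: "\<epsilon> > 0"
    and d: "avg_degree {..<n} C \<le> d"
  defines "K \<equiv> 1500 * (1 + \<bar>d\<bar>)"
  shows "\<exists>t s. exec sparsify (input_state n cs w \<epsilon>) t s \<and>
    augmented_cut_sparsifier \<epsilon> {..<n} C w (output_nodes s - {..<n}) (output_edges s) (output_weight s) \<and>
    (\<epsilon> < accuracy_threshold \<and> n > 0 \<longrightarrow>
       real (card ({..<n} \<union> output_nodes s)) \<le> K * (real n * sparsity_factor \<epsilon>) \<and>
       real (card (output_edges s)) \<le> K * (real n * sparsity_factor \<epsilon>) \<and>
       real t \<le> K * (real n * sparsity_factor \<epsilon>))"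
proof -
  define J m where "J = piece_count \<epsilon>" and "m = (\<Sum>c\<in>C. card c)"
  obtain t s where s: "exec sparsify (input_state n cs w \<epsilon>) t s"
    "augmented_cut_sparsifier \<epsilon> {..<n} C w (output_nodes s - {..<n}) (output_edges s) (output_weight s)"
    and bounds: "card ({..<n} \<union> output_nodes s) \<le> n + J * m"
      "card (output_edges s) \<le> 2 * J * m" "t \<le> J * (20 + 275 * m)"
    using sparsify_correct[OF inst enum \<epsilon>] unfolding J_def m_def by blast
  \<comment> \<open>All three quantities fit under \<open>300 * J * (n + m)\<close>, where
    \<open>m\<close> is at most \<open>n * \<bar>d\<bar>\<close>; with the factor 5 of
    \<open>piece_count_le\<close> this gives the 1500 in \<open>K\<close>.\<close>
  have goal: "real x \<le> K * (real n * sparsity_factor \<epsilon>)"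
    if x: "x \<le> 300 * J * (n + m)" and small: "\<epsilon> < accuracy_threshold" for x
  proof -
    have "real m = real n * avg_degree {..<n} C"
      using sum_cooc_degree[OF inst] by (simp add: m_def)
    also have "\<dots> \<le> real n * \<bar>d\<bar>" using d by (intro mult_left_mono) auto
    finally have m: "real (n + m) \<le> real n * (1 + \<bar>d\<bar>)" by (simp add: algebra_simps)
    have "real x \<le> real (300 * J * (n + m))" using x by (simp only: of_nat_le_iff)
    also have "\<dots> = 300 * real J * real (n + m)" by simp
    also have "\<dots> \<le> 300 * (5 * sparsity_factor \<epsilon>) * (real n * (1 + \<bar>d\<bar>))"
      using piece_count_le[OF \<epsilon> small, folded J_def] m
      by (intro mult_mono mult_left_mono) auto
    also have "\<dots> = K * (real n * sparsity_factor \<epsilon>)" by (simp add: K_def)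
    finally show ?thesis .
  qed
  have J: "1 \<le> J" using piece_count(1)[OF \<epsilon>] by (simp add: J_def)
  have "n + J * m \<le> 300 * J * (n + m)" "2 * J * m \<le> 300 * J * (n + m)"
    "n > 0 \<Longrightarrow> J * (20 + 275 * m) \<le> 300 * J * (n + m)"
  proof -
    \<comment> \<open>The cost \<open>20 * J\<close> of the search is charged to the nodes, which
      takes at least one node.\<close>
    have n: "n \<le> J * n" "0 < n \<Longrightarrow> J \<le> J * n" using J by auto
    have eqs: "300 * J * (n + m) = 300 * (J * n) + 300 * (J * m)" "2 * J * m = 2 * (J * m)"
      "J * (20 + 275 * m) = 20 * J + 275 * (J * m)" by (simp_all add: algebra_simps)
    show "n + J * m \<le> 300 * J * (n + m)" "2 * J * m \<le> 300 * J * (n + m)"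
      unfolding eqs using n(1) by linarith+
    show "J * (20 + 275 * m) \<le> 300 * J * (n + m)" if "n > 0"
      unfolding eqs using n(2)[OF that] by linarith
  qed
  then show ?thesis using s bounds goal by (meson le_trans)
qed

theorem theorem4:
  shows
    "(\<exists>K>0. \<exists>\<epsilon>0>0. \<forall>(V :: 'a::infinite set) C w. cooccurrence_instance V C w \<longrightarrow>
        (\<forall>\<epsilon>>0. \<exists>A E x. augmented_cut_sparsifier \<epsilon> V C w A E x \<and>
           (\<epsilon> < \<epsilon>0 \<longrightarrow>
              real (card (V \<union> A)) \<le> K * (real (card V) + real (card C) * sparsity_factor \<epsilon>) \<and>
              real (card E) \<le> K * (real (card V) * avg_degree V C * sparsity_factor \<epsilon>)))) \<and>
     (\<exists>P. \<forall>(n :: nat \<Rightarrow> nat) (C :: nat \<Rightarrow> nat set set) (w :: nat \<Rightarrow> nat set \<Rightarrow> real) d \<delta>.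
        (\<forall>k. cooccurrence_instance {..<n k} (C k) (w k)) \<longrightarrow>
        filterlim n at_top sequentially \<longrightarrow>
        (\<forall>k. avg_degree {..<n k} (C k) \<le> d) \<longrightarrow>
        \<delta> > 0 \<longrightarrow>
        (\<lambda>k. \<Sum>c\<in>C k. real (card c) ^ 2) \<in> \<Omega>(\<lambda>k. real (n k) powr (1 + \<delta>)) \<longrightarrow>
        (\<forall>Q T. (\<forall>k. forms_explicitly Q (n k) (C k) (w k) (T k)) \<longrightarrow>
           (\<lambda>k. real (T k)) \<in> \<Omega>(\<lambda>k. real (n k) powr (1 + \<delta>))) \<and>
        (\<exists>K>0. \<exists>\<epsilon>0>0. \<forall>k cs. enumerates cs (C k) \<longrightarrow>
           (\<forall>\<epsilon>>0. \<exists>t s. exec P (input_state (n k) cs (w k) \<epsilon>) t s \<and>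
              augmented_cut_sparsifier \<epsilon> {..<n k} (C k) (w k)
                (output_nodes s - {..<n k}) (output_edges s) (output_weight s) \<and>
              (\<epsilon> < \<epsilon>0 \<and> n k > 0 \<longrightarrow>
                 real (card ({..<n k} \<union> output_nodes s)) \<le> K * (real (n k) * sparsity_factor \<epsilon>) \<and>
                 real (card (output_edges s)) \<le> K * (real (n k) * sparsity_factor \<epsilon>) \<and>
                 real t \<le> K * (real (n k) * sparsity_factor \<epsilon>)))))"
\<comment> \<open>The single program \<open>sparsify\<close> serves all families of instances; the
  constant depends on the family only through \<open>d\<close>, and the accuracy threshold is
  absolute.\<close>
proof (rule conjI[OF sparsifier_size], rule exI[of _ sparsify], intro allI impI conjI, goal_cases)
  case (1 n C w d \<delta> Q T)
  show ?case
  proof (rule explicit_time_lower_bound[where d = d])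
    fix k
    have "(\<Sum>c\<in>C k. real (card c)) = real (n k) * avg_degree {..<n k} (C k)"
      using sum_cooc_degree[of "{..<n k}" "C k" "w k"] 1 by simp
    also have "\<dots> \<le> real (n k) * d" using 1 by (intro mult_left_mono) auto
    finally show "(\<Sum>c\<in>C k. real (card c) ^ 2) \<le> 2 * real (T k) + real (n k) * d"
      using sum_card_squares_le[of Q "n k" "C k" "w k" "T k"] 1 by fastforce
  qed (use 1 in \<open>auto intro: sum_nonneg\<close>)
next
  case (2 n C w d \<delta>)
  then show ?case
    using sparsify_resources[where d = d]
    by (intro exI[of _ "1500 * (1 + \<bar>d\<bar>)"] exI[of _ accuracy_threshold] conjI)
      (auto simp: accuracy_threshold_def add_pos_nonneg)
qed

end
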